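(* Let $1\le k\le n$, and let $u:\mathbb{C}^n\to\mathbb{R}$ be a smooth $k$-plurisubharmonic function satisfying, on $\mathbb{C}^n$, $$-\frac{\sigma_{k-1}}{\sigma_k}(\partial\bar\partial u)=\frac{1}{2}\,x\cdot Du-u.$$ Then $u$ is a quadratic polynomial.
   Context: For $1\le k\le n$, $\sigma_k(\lambda)=\sum_{i_1<\cdots<i_k}\lambda_{i_1}\cdots\lambda_{i_k}$ for $\lambda\in\mathbb{R}^n$ is the $k$-th elementary symmetric polynomial, with $\sigma_0=1$, and $\Gamma_k=\{\lambda\in\mathbb{R}^n\mid\sigma_j(\lambda)>0,\ 1\le j\le k\}$. For a Hermitian matrix $A$, $\lambda(A)$ denotes its eigenvalues. A $C^2$ function $u$ on $\mathbb{C}^n$ is called $k$-plurisubharmonic if $\lambda(\partial\bar\partial u)\in\Gamma_k$ everywhere, and $-\frac{\sigma_{k-1}}{\sigma_k}(\partial\bar\partial u)=-\frac{\sigma_{k-1}(\lambda(\partial\bar\partial u))}{\sigma_k(\lambda(\partial\bar\partial u))}$. Identify $\mathbb{C}^n$ with $\mathbb{R}^{2n}$ via $z_k=x_k+\sqrt{-1}\,y_k$; in the equation $x$ denotes the position vector in $\mathbb{R}^{2n}$, $Du$ the real gradient, and "$\cdot$" the Euclidean inner product on $\mathbb{R}^{2n}$. The complex Hessian is the Hermitian matrix $\partial\bar\partial u=\left(\frac{\partial^2u}{\partial z_i\partial\bar z_j}\right)_{1\le i,j\le n}$ with $\frac{\partial}{\partial z_k}=\frac12\left(\frac{\partial}{\partial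 x_k}-\sqrt{-1}\frac{\partial}{\partial y_k}\right)$ and $\frac{\partial}{\partial \bar z_k}=\frac12\left(\frac{\partial}{\partial x_k}+\sqrt{-1}\frac{\partial}{\partial y_k}\right)$. "Quadratic polynomial" means a real polynomial of degree at most $2$ in the real coordinates (equivalently, the real Hessian $D^2u$ is constant). *)

theory Defs
  imports
    "HOL-Analysis.Analysis"
    "HOL-Computational_Algebra.Fundamental_Theorem_Algebra"
begin

text \<open>
  Complex $n$-space is \<^typ>\<open>complex ^ 'n\<close> with $n = $ \<^term>\<open>CARD('n)\<close>. Its type class inner product
  \<^term>\<open>z \<bullet> w\<close> is the real one, i.e. the Euclidean inner product of $(x_1,y_1,\dots,x_n,y_n)$ under
  $z_k = x_k + i y_k$, and \<^term>\<open>Basis :: (complex ^ 'n) set\<close> consists of the $2n$ real coordinate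
  vectors \<^term>\<open>axis k 1\<close> and \<^term>\<open>axis k \<i>\<close>.
\<close>

section \<open>Elementary symmetric polynomials and the cones $\Gamma_k$\<close>

definition esym :: "nat \<Rightarrow> real ^ 'n \<Rightarrow> real" where
  "esym k l = (\<Sum>S | S \<subseteq> UNIV \<and> card S = k. \<Prod>i\<in>S. l $ i)"

definition Gamma_cone :: "nat \<Rightarrow> (real ^ 'n) set" where
  "Gamma_cone k = {l. \<forall>j. 1 \<le> j \<and> j \<le> k \<longrightarrow> esym j l > 0}"

section \<open>Eigenvalues of Hermitian matrices\<close>

definition hermitian :: "complex ^ 'n ^ 'n \<Rightarrow> bool" where
  "hermitian A \<longleftrightarrow> (\<forall>i j. A $ j $ i = cnj (A $ i $ j))"

definition charpoly :: "complex ^ 'n ^ 'n \<Rightarrow> complex poly" where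
  "charpoly A = det (\<chi> i j. (if i = j then [:0, 1:] else 0) - [:A $ i $ j:])"

text \<open>
  The eigenvalues listed with multiplicity, in an unspecified order; this is only meaningful for
  matrices with real spectrum. See \<open>charpoly_eigenvalues\<close> below for existence.
\<close>

definition eigenvalues :: "complex ^ 'n ^ 'n \<Rightarrow> real ^ 'n" where
  "eigenvalues A = (SOME l. charpoly A = (\<Prod>i\<in>UNIV. [:- complex_of_real (l $ i), 1:]))"

lemma poly_charpoly: "poly (charpoly A) z = det (mat z - A)"
  by (simp add: charpoly_def det_def poly_sum poly_prod mat_def if_distrib[of "\<lambda>p. poly p _"] cong: if_cong)

lemma charpoly_monic:
  fixes A :: "complex ^ 'n ^ 'n"
  shows "degree (charpoly A) = CARD('n)" and "lead_coeff (charpoly A) = 1"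
proof -
  define M :: "complex poly ^ 'n ^ 'n"
    where "M = (\<chi> i j. (if i = j then [:0, 1:] else 0) - [:A $ i $ j:])"
  define P where "P = {p :: 'n \<Rightarrow> 'n. p permutes UNIV}"
  define t where "t p = of_int (sign p) * (\<Prod>i\<in>UNIV. M $ i $ p i)" for p
  have fin: "finite P" and id: "id \<in> P"
    by (simp_all add: P_def permutes_id)
  have *: "charpoly A = t id + (\<Sum>p\<in>P - {id}. t p)"
    using sum.remove[OF fin id, of t]
    by (simp add: charpoly_def det_def M_def t_def P_def)
  have tid: "t id = (\<Prod>i\<in>UNIV. [:- A $ i $ i, 1:])"
    by (simp add: t_def M_def)
  have deg_id: "degree (t id) = CARD('n)"
    unfolding tid by (subst degree_prod_sum_eq) auto
  have lead_id: "lead_coeff (t id) = 1"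
    unfolding tid by (simp add: lead_coeff_prod)
  have less: "degree (t p) < CARD('n)" if p: "p \<in> P - {id}" for p
  proof -
    obtain j where j: "p j \<noteq> j" using p by (auto simp: fun_eq_iff)
    have "degree (t p) \<le> degree (of_int (sign p) :: complex poly) + degree (\<Prod>i\<in>UNIV. M $ i $ p i)"
      unfolding t_def by (rule degree_mult_le)
    also have "\<dots> = degree (\<Prod>i\<in>UNIV. M $ i $ p i)" by simp
    also have "\<dots> \<le> (\<Sum>i\<in>UNIV. degree (M $ i $ p i))"
      using degree_prod_sum_le[of UNIV "\<lambda>i. M $ i $ p i"] by (simp add: comp_def)
    also have "\<dots> < (\<Sum>i\<in>(UNIV :: 'n set). 1)"
    proof (rule sum_strict_mono_ex1)
      show "\<forall>i\<in>UNIV. degree (M $ i $ p i) \<le> 1" by (simp add: M_def)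
      have "degree (M $ j $ p j) < 1" using j[symmetric] by (simp add: M_def)
      then show "\<exists>i\<in>UNIV. degree (M $ i $ p i) < 1" by blast
    qed simp
    finally show ?thesis by simp
  qed
  have "degree (\<Sum>p\<in>P - {id}. t p) < CARD('n)"
    by (rule degree_sum_less) (use less in auto)
  then show "degree (charpoly A) = CARD('n)" and "lead_coeff (charpoly A) = 1"
    using deg_id lead_id unfolding *
    by (simp_all add: degree_add_eq_left coeff_eq_0)
qed

lemma charpoly_root_real:
  fixes A :: "complex ^ 'n ^ 'n"
  assumes A: "hermitian A" and z: "poly (charpoly A) z = 0"
  shows "z \<in> \<real>"
proof -
  have "\<not> invertible (mat z - A)"
    using z by (simp add: poly_charpoly invertible_det_nz)
  then obtain v where v: "(mat z - A) *v v = 0" "v \<noteq> 0"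
    by (auto simp: invertible_left_inverse matrix_left_invertible_ker)
  have Av: "(\<Sum>j\<in>UNIV. A $ i $ j * v $ j) = z * v $ i" for i
  proof -
    have "((mat z - A) *v v) $ i = z * v $ i - (\<Sum>j\<in>UNIV. A $ i $ j * v $ j)"
      by (simp add: matrix_vector_mult_def mat_def left_diff_distrib sum_subtractf
          if_distrib[of "\<lambda>x. x * _"] cong: if_cong)
    with v(1) show ?thesis by simp
  qed
  define q where "q = (\<Sum>i\<in>UNIV. cnj (v $ i) * (\<Sum>j\<in>UNIV. A $ i $ j * v $ j))"
  define N where "N = (\<Sum>i\<in>UNIV. cnj (v $ i) * v $ i)"
  have q: "q = z * N"
    unfolding q_def N_def Av sum_distrib_left by (intro sum.cong refl) simp
  have "cnj q = (\<Sum>i\<in>UNIV. \<Sum>j\<in>UNIV. v $ i * (A $ j $ i * cnj (v $ j)))"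
    by (simp add: q_def sum_distrib_left flip: A[unfolded hermitian_def, rule_format])
  also have "\<dots> = (\<Sum>j\<in>UNIV. \<Sum>i\<in>UNIV. v $ i * (A $ j $ i * cnj (v $ j)))"
    by (rule sum.swap)
  also have "\<dots> = q"
    by (simp add: q_def sum_distrib_left mult_ac)
  finally have "cnj q = q" .
  have N: "N = of_real (\<Sum>i\<in>UNIV. (norm (v $ i))\<^sup>2)"
    unfolding N_def of_real_sum
    by (intro sum.cong refl) (metis complex_norm_square mult.commute)
  obtain i where "v $ i \<noteq> 0" using v(2) by (auto simp: vec_eq_iff)
  then have "(\<Sum>i\<in>UNIV. (norm (v $ i))\<^sup>2) > 0"
    by (intro sum_pos2[of _ i]) auto
  then have "N \<noteq> 0" "cnj N = N"
    unfolding N of_real_eq_0_iff complex_cnj_complex_of_real by linarith simp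
  with \<open>cnj q = q\<close> q have "cnj z = z" by simp
  then show ?thesis by (simp add: Reals_cnj_iff)
qed

lemma charpoly_eigenvalues:
  fixes A :: "complex ^ 'n ^ 'n"
  assumes "hermitian A"
  shows "charpoly A = (\<Prod>i\<in>UNIV. [:- complex_of_real (eigenvalues A $ i), 1:])"
proof -
  obtain rs where rs: "mset rs = proots (charpoly A)" by (metis ex_mset)
  have cp: "charpoly A = (\<Prod>x\<leftarrow>rs. [:- x, 1:])"
    using complex_poly_decompose_multiset[of "charpoly A"] charpoly_monic(2)[of A]
    by (simp flip: rs prod_mset_prod_list)
  have len: "length rs = CARD('n)"
    using size_proots_complex[of "charpoly A"] by (simp flip: rs add: charpoly_monic(1))
  have real: "x \<in> \<real>" if "x \<in> set rs" for x
  proof (rule charpoly_root_real[OF assms])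
    have "charpoly A \<noteq> 0" using charpoly_monic(2)[of A] by force
    then show "poly (charpoly A) x = 0"
      using that rs by (metis set_mset_mset set_count_proots mem_Collect_eq)
  qed
  obtain h :: "'n \<Rightarrow> nat" where h: "bij_betw h UNIV {..<CARD('n)}"
    using ex_bij_betw_finite_nat[of "UNIV :: 'n set"] by (auto simp: atLeast0LessThan)
  define l :: "real ^ 'n" where "l = (\<chi> i. Re (rs ! h i))"
  have l: "complex_of_real (l $ i) = rs ! h i" for i
  proof -
    have "h i < length rs" using bij_betwE[OF h] len by simp
    then have "rs ! h i \<in> \<real>" by (intro real nth_mem)
    then show ?thesis by (simp add: l_def)
  qed
  have "charpoly A = (\<Prod>k<CARD('n). [:- (rs ! k), 1:])"
    by (simp add: cp prod.list_conv_set_nth len atLeast0LessThan)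
  also have "\<dots> = (\<Prod>i\<in>UNIV. [:- complex_of_real (l $ i), 1:])"
    by (simp add: l prod.reindex_bij_betw[OF h, of "\<lambda>k. [:- (rs ! k), 1:]"])
  finally show ?thesis
    unfolding eigenvalues_def by (rule someI)
qed

section \<open>Differential operators\<close>

text \<open>\<open>C_k_fun m f\<close>: the function \<open>f\<close> is of class $C^m$ on the whole space.\<close>

primrec C_k_fun :: "nat \<Rightarrow> ('a::real_normed_vector \<Rightarrow> 'b::real_normed_vector) \<Rightarrow> bool" where
  "C_k_fun 0 f \<longleftrightarrow> continuous_on UNIV f"
| "C_k_fun (Suc m) f \<longleftrightarrow> (\<forall>x. f differentiable at x) \<and>
     (\<forall>v. C_k_fun m (\<lambda>x. frechet_derivative f (at x) v))"

definition smooth :: "('a::real_normed_vector \<Rightarrow> 'b::real_normed_vector) \<Rightarrow> bool" where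
  "smooth f \<longleftrightarrow> (\<forall>m. C_k_fun m f)"

definition partial_x :: "'n \<Rightarrow> (complex ^ 'n \<Rightarrow> 'b::real_normed_vector) \<Rightarrow> complex ^ 'n \<Rightarrow> 'b" where
  "partial_x k f z = frechet_derivative f (at z) (axis k 1)"

definition partial_y :: "'n \<Rightarrow> (complex ^ 'n \<Rightarrow> 'b::real_normed_vector) \<Rightarrow> complex ^ 'n \<Rightarrow> 'b" where
  "partial_y k f z = frechet_derivative f (at z) (axis k \<i>)"

definition partial_z :: "'n \<Rightarrow> (complex ^ 'n \<Rightarrow> complex) \<Rightarrow> complex ^ 'n \<Rightarrow> complex" where
  "partial_z k f z = (1/2) * (partial_x k f z - \<i> * partial_y k f z)"

definition partial_zbar :: "'n \<Rightarrow> (complex ^ 'n \<Rightarrow> complex) \<Rightarrow> complex ^ 'n \<Rightarrow> complex" where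
  "partial_zbar k f z = (1/2) * (partial_x k f z + \<i> * partial_y k f z)"

definition complex_hessian :: "(complex ^ 'n \<Rightarrow> real) \<Rightarrow> complex ^ 'n \<Rightarrow> complex ^ 'n ^ 'n" where
  "complex_hessian u z = (\<chi> i j. partial_z i (partial_zbar j (\<lambda>w. complex_of_real (u w))) z)"

text \<open>The gradient in $\mathbb{R}^{2n}$, with the pair $(u_{x_k}, u_{y_k})$ stored as one complex entry.\<close>

definition real_grad :: "(complex ^ 'n \<Rightarrow> real) \<Rightarrow> complex ^ 'n \<Rightarrow> complex ^ 'n" where
  "real_grad u z = (\<chi> k. Complex (partial_x k u z) (partial_y k u z))"

definition k_plurisubharmonic :: "nat \<Rightarrow> (complex ^ 'n \<Rightarrow> real) \<Rightarrow> bool" where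
  "k_plurisubharmonic k u \<longleftrightarrow>
     C_k_fun 2 u \<and> (\<forall>z. eigenvalues (complex_hessian u z) \<in> Gamma_cone k)"

section \<open>Quadratic polynomials\<close>

text \<open>Real polynomials of degree at most 2 in the real coordinates \<^term>\<open>x \<bullet> p\<close>, \<^term>\<open>p \<in> Basis\<close>.\<close>

definition quadratic_polynomial :: "('a::euclidean_space \<Rightarrow> real) \<Rightarrow> bool" where
  "quadratic_polynomial u \<longleftrightarrow> (\<exists>(a :: 'a \<Rightarrow> 'a \<Rightarrow> real) (b :: 'a \<Rightarrow> real) (c :: real). \<forall>x.
     u x = (\<Sum>p\<in>Basis. \<Sum>q\<in>Basis. a p q * (x \<bullet> p) * (x \<bullet> q)) + (\<Sum>p\<in>Basis. b p * (x \<bullet> p)) + c)"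

end

theory Submission
  imports Defs
begin

text \<open>
  Let \<open>f = \<sigma>\<^sub>k\<^sub>-\<^sub>1 / \<sigma>\<^sub>k\<close>, evaluated at the complex Hessian of \<open>u\<close>. Differentiating the equation twice shows
  \<open>F\<^sup>i\<^sup>j f\<^sub>i\<^sub>j = x \<bullet> Df / 2\<close>, where \<open>F\<^sup>i\<^sup>j\<close> is the linearisation of \<open>- \<sigma>\<^sub>k\<^sub>-\<^sub>1 / \<sigma>\<^sub>k\<close>; it is positive definite
  on \<open>\<Gamma>\<^sub>k\<close> by Newton's inequality and has trace at most \<open>n f\<^sup>2\<close>. The trace bound is useful precisely where
  \<open>f\<close> is small, so comparison of \<open>f > 0\<close> with \<open>- \<epsilon> \<bar>x\<bar>\<^sup>2\<close> from below shows that \<open>f\<close> attains its infimum, and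
  comparison with a Gaussian shows that \<open>f\<close> is constant. Then \<open>u - f\<close> is homogeneous of degree 2 and
  \<open>C\<^sup>2\<close> at the origin, hence quadratic.
\<close>

section \<open>Newton's inequality\<close>

text \<open>The drift equation comes from reading \<open>f\<close> in two ways. As
  \<open>u - x . Du / 2\<close> its Hessian is minus half the derivative of \<open>D^2 u\<close>
  along \<open>x\<close>; as a quotient of symmetric functions its derivative along \<open>x\<close>
  is the linearised operator applied to the same third derivatives. Only the first variation of the
  quotient therefore enters. The obstacle is that the space is not compact and neither the growth of
  \<open>u\<close> nor the linearised operator is bounded a priori. Both comparisons evaluate the
  operator only where \<open>f\<close> lies below a known constant. There the trace is bounded, so
  far from the origin the drift \<open>x / 2\<close> wins against it, and only a compact region
  remains. The trace bound arises by discarding the nonpositive part of the derivative of the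
  quotient in each eigenvalue: what is left sums to \<open>(n - k + 1) * f^2\<close>.\<close>

text \<open>These are the real-rooted polynomials together with zero: a factor with
  \<open>b = 0\<close> is a constant, and \<open>(0, 0)\<close> yields the zero polynomial. Allowing
  these degenerate factors makes the class closed under differentiation.\<close>

definition real_split :: "complex poly \<Rightarrow> bool" where
  "real_split p \<longleftrightarrow>
     (\<exists>xs :: (real \<times> real) list. p = (\<Prod>(a, b)\<leftarrow>xs. [:complex_of_real a, complex_of_real b:]))"

lemma real_split_coeff:
  assumes "real_split p"
  shows "coeff p n \<in> \<real>"
proof -
  have "coeff (\<Prod>(a, b)\<leftarrow>xs. [:complex_of_real a, complex_of_real b:]) n \<in> \<real>" for xs
  proof (induction xs arbitrary: n)
    case Nil
    then show ?case by (cases n) auto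
  next
    case (Cons x xs)
    then show ?case by (cases x; cases n) (auto simp: coeff_pCons intro!: Reals_add Reals_mult)
  qed
  with assms show ?thesis unfolding real_split_def by blast
qed

text \<open>The inequality expresses that \<open>p'/p\<close> is decreasing.\<close>

lemma real_split_laguerre:
  assumes "real_split p"
  shows "\<exists>v\<ge>0. (poly (pderiv p) 0)\<^sup>2 - poly p 0 * poly (pderiv (pderiv p)) 0 = complex_of_real v"
proof -
  have "\<exists>v\<ge>0. (poly (pderiv p) 0)\<^sup>2 - poly p 0 * poly (pderiv (pderiv p)) 0 = complex_of_real v"
    if "p = (\<Prod>(a, b)\<leftarrow>xs. [:complex_of_real a, complex_of_real b:])" for xs p
    using that
  proof (induction xs arbitrary: p)
    case Nil
    show ?case by (rule exI[of _ 0]) (simp add: Nil)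
  next
    case (Cons x xs)
    obtain a b where x: "x = (a, b)" by (cases x)
    define q where "q = (\<Prod>(a, b)\<leftarrow>xs. [:complex_of_real a, complex_of_real b:])"
    have "real_split q" unfolding real_split_def q_def by blast
    then have "coeff q 0 \<in> \<real>" by (rule real_split_coeff)
    then obtain c where c: "poly q 0 = complex_of_real c"
      by (metis Reals_cases poly_0_coeff_0)
    obtain v where v: "v \<ge> 0"
      "(poly (pderiv q) 0)\<^sup>2 - poly q 0 * poly (pderiv (pderiv q)) 0 = complex_of_real v"
      using Cons.IH[OF q_def] by blast
    define r where "r = [:complex_of_real a, complex_of_real b:]"
    have p: "p = r * q" using Cons.prems by (simp add: x q_def r_def)
    have r: "poly r 0 = a" "poly (pderiv r) 0 = b" "pderiv (pderiv r) = 0"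
      by (simp_all add: r_def pderiv_pCons)
    \<comment> \<open>A linear factor \<open>r\<close> has no second derivative, so passing from
      \<open>q\<close> to \<open>r * q\<close> multiplies the old quantity by the square
      \<open>r(0)^2\<close> and adds the square \<open>(b * q(0))^2\<close>.\<close>
    have "(poly (pderiv p) 0)\<^sup>2 - poly p 0 * poly (pderiv (pderiv p)) 0
        = (complex_of_real a)\<^sup>2 * ((poly (pderiv q) 0)\<^sup>2 - poly q 0 * poly (pderiv (pderiv q)) 0)
          + (poly q 0)\<^sup>2 * (complex_of_real b)\<^sup>2"
      unfolding p pderiv_mult pderiv_add poly_add poly_mult r
      by (simp add: algebra_simps power2_eq_square)
    also have "\<dots> = complex_of_real (a\<^sup>2 * v + c\<^sup>2 * b\<^sup>2)"
      unfolding v(2) unfolding c by simp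
    finally show ?case using v(1) by (intro exI[of _ "a\<^sup>2 * v + c\<^sup>2 * b\<^sup>2"]) simp
  qed
  with assms show ?thesis unfolding real_split_def by blast
qed

text \<open>The quotient \<open>p' / p\<close> is the sum of the terms
  \<open>b / (a + b * z)\<close>, whose imaginary parts \<open>- b^2 * Im z / |a + b z|^2\<close>
  all have the sign opposite to \<open>Im z\<close>. They cannot cancel, so a nonreal critical point
  forces every \<open>b\<close> to vanish.\<close>

lemma Im_logarithmic_derivative:
  fixes xs :: "(real \<times> real) list" and z :: complex
  defines "p \<equiv> \<Prod>(a, b)\<leftarrow>xs. [:complex_of_real a, complex_of_real b:]"
  assumes "p \<noteq> 0" and z: "Im z \<noteq> 0"
  shows "poly p z \<noteq> 0 \<and>
    (\<exists>c\<ge>0. Im (poly (pderiv p) z / poly p z) = - c * Im z \<and> (c = 0 \<longrightarrow> pderiv p = 0))"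
  using assms(2) unfolding p_def
proof (induction xs)
  case Nil
  then show ?case by (auto intro!: exI[of _ 0])
next
  case (Cons x xs)
  obtain a b where x: "x = (a, b)" by (cases x)
  define q where "q = (\<Prod>(a, b)\<leftarrow>xs. [:complex_of_real a, complex_of_real b:])"
  define r where "r = [:complex_of_real a, complex_of_real b:]"
  have "r \<noteq> 0" "q \<noteq> 0" using Cons.prems by (auto simp: x q_def r_def)
  obtain c where c: "poly q z \<noteq> 0" "c \<ge> 0" "Im (poly (pderiv q) z / poly q z) = - c * Im z"
    "c = 0 \<Longrightarrow> pderiv q = 0"
    using Cons.IH \<open>q \<noteq> 0\<close> unfolding q_def by blast
  have rz: "poly r z \<noteq> 0"
  proof
    assume "poly r z = 0"
    then have "a + b * Re z = 0" "b * Im z = 0"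
      by (auto simp: r_def complex_eq_iff algebra_simps)
    with z \<open>r \<noteq> 0\<close> show False by (auto simp: r_def)
  qed
  define d where "d = b\<^sup>2 / ((a + b * Re z)\<^sup>2 + (b * Im z)\<^sup>2)"
  have "Im (poly (pderiv r) z / poly r z) = - d * Im z"
    by (simp add: d_def r_def pderiv_pCons Im_divide power2_eq_square algebra_simps)
  moreover have "poly (pderiv (r * q)) z / poly (r * q) z
      = poly (pderiv r) z / poly r z + poly (pderiv q) z / poly q z"
    using rz c(1) by (simp add: pderiv_mult field_simps)
  ultimately have "Im (poly (pderiv (r * q)) z / poly (r * q) z) = - (d + c) * Im z"
    using c(3) by (simp add: algebra_simps)
  moreover have "d + c \<ge> 0" using c(2) by (simp add: d_def)
  moreover have "pderiv (r * q) = 0" if "d + c = 0"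
  proof -
    have "d \<ge> 0" by (simp add: d_def)
    with that c(2) have "d = 0" "c = 0" by linarith+
    then have "b = 0 \<or> (a + b * Re z = 0 \<and> b * Im z = 0)"
      by (simp add: d_def sum_power2_eq_zero_iff)
    then have "b = 0" using z by auto
    then show ?thesis using c(4) \<open>c = 0\<close> by (simp add: pderiv_smult pderiv_mult r_def pderiv_pCons)
  qed
  moreover have "poly (r * q) z \<noteq> 0" using rz c(1) by simp
  moreover have "(\<Prod>(a, b)\<leftarrow>x # xs. [:complex_of_real a, complex_of_real b:]) = r * q"
    by (simp add: x q_def r_def)
  ultimately show ?case by (metis mult_minus_left)
qed

text \<open>Nonreal zeros of \<open>p'\<close> are excluded by the logarithmic derivative, so the
  complex factorisation of \<open>p'\<close> is already a real one; multiplicities need no separate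
  count.\<close>

lemma real_split_pderiv:
  assumes "real_split p"
  shows "real_split (pderiv p)"
proof (cases "pderiv p = 0")
  case True
  then show ?thesis unfolding real_split_def by (intro exI[of _ "[(0, 0)]"]) simp
next
  case False
  then have "p \<noteq> 0" by auto
  obtain rs where rs: "mset rs = proots (pderiv p)" by (metis ex_mset)
  have real: "z \<in> \<real>" if "z \<in> set rs" for z
  proof (rule ccontr)
    assume "z \<notin> \<real>"
    then have z: "Im z \<noteq> 0" by (simp add: complex_is_Real_iff)
    have "poly (pderiv p) z = 0"
      using that rs False by (metis set_mset_mset set_count_proots mem_Collect_eq)
    with z Im_logarithmic_derivative[OF _ z] assms \<open>p \<noteq> 0\<close> False show False
      unfolding real_split_def by fastforce
  qed
  have "coeff (pderiv p) (degree (pderiv p)) \<in> \<real>"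
    using real_split_coeff[OF assms] by (simp add: coeff_pderiv)
  then obtain c where c: "lead_coeff (pderiv p) = complex_of_real c" by (auto elim: Reals_cases)
  have "pderiv p = smult (lead_coeff (pderiv p)) (\<Prod>x\<leftarrow>rs. [:-x, 1:])"
    using complex_poly_decompose_multiset[of "pderiv p"] by (simp flip: rs prod_mset_prod_list)
  also have "(\<Prod>x\<leftarrow>rs. [:-x, 1:]) = (\<Prod>x\<leftarrow>rs. [:complex_of_real (- Re x), complex_of_real 1:])"
    using real by (intro arg_cong[of _ _ prod_list] map_cong) (auto elim!: Reals_cases)
  finally show ?thesis unfolding real_split_def c
    by (intro exI[of _ "(c, 0) # map (\<lambda>z. (- Re z, 1)) rs"]) (simp add: comp_def)
qed

text \<open>The generating function form permits an arbitrary index set, so that a variable can be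
  deleted, and it turns statements about symmetric functions into statements about one
  polynomial.\<close>

definition elem_sym :: "'a set \<Rightarrow> ('a \<Rightarrow> real) \<Rightarrow> nat \<Rightarrow> real" where
  "elem_sym S l j = coeff (\<Prod>i\<in>S. [:1, l i:]) j"

lemma elem_sym_complex: "coeff (\<Prod>i\<in>S. [:1, complex_of_real (l i):]) j = complex_of_real (elem_sym S l j)"
  unfolding elem_sym_def
  by (induction S arbitrary: j rule: infinite_finite_induct)
    (auto simp: coeff_pCons split: nat.split)

lemma elem_sym_0 [simp]: "elem_sym S l 0 = 1"
  unfolding elem_sym_def by (induction S rule: infinite_finite_induct) auto

lemma elem_sym_remove:
  assumes "finite S" "i \<in> S"
  shows "elem_sym S l (Suc j) = elem_sym (S - {i}) l (Suc j) + l i * elem_sym (S - {i}) l j"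
  unfolding elem_sym_def by (subst prod.remove[OF assms]) simp

lemma esym_eq_elem_sym: "esym j l = elem_sym UNIV (($) l) j"
proof -
  have "(\<Prod>i\<in>UNIV. [:1, l $ i:]) = (\<Prod>i\<in>UNIV. monom (l $ i) 1 + 1)"
    by (intro prod.cong) (auto simp: monom_Suc monom_0 one_pCons)
  also have "\<dots> = (\<Sum>X\<in>Pow UNIV. \<Prod>i\<in>X. monom (l $ i) 1)"
    by (subst prod_add) auto
  also have "\<dots> = (\<Sum>X\<in>UNIV. monom (\<Prod>i\<in>X. l $ i) (card X))"
  proof (intro sum.cong)
    show "(\<Prod>i\<in>X. monom (l $ i) 1) = monom (\<Prod>i\<in>X. l $ i) (card X)" for X
      by (induction X rule: infinite_finite_induct) (auto simp: mult_monom)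
  qed auto
  finally have "elem_sym UNIV (($) l) j = (\<Sum>X\<in>UNIV. if card X = j then \<Prod>i\<in>X. l $ i else 0)"
    by (simp add: elem_sym_def coeff_sum)
  also have "\<dots> = esym j l"
    by (simp add: esym_def sum.If_cases)
  finally show ?thesis ..
qed

text \<open>The product of the \<open>1 + l i * z\<close> is real-rooted, hence so is its
  \<open>j\<close>-th derivative, whose first three Taylor data at 0 are \<open>j!\<close>,
  \<open>(j+1)!\<close> and \<open>(j+2)!\<close> times consecutive symmetric functions. The
  Laguerre inequality at 0, divided by \<open>j! * (j+1)!\<close>, is the claim.\<close>

lemma newton_inequality:
  "real (j + 2) * (elem_sym S l j * elem_sym S l (j + 2)) \<le> real (j + 1) * (elem_sym S l (j + 1))\<^sup>2"
proof (cases "finite S")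
  case True
  define p where "p = (\<Prod>i\<in>S. [:1, complex_of_real (l i):])"
  obtain xs where xs: "set xs = S" "distinct xs" using finite_distinct_list[OF True] by blast
  have "p = (\<Prod>(a, b)\<leftarrow>map (\<lambda>i. (1, l i)) xs. [:complex_of_real a, complex_of_real b:])"
    unfolding p_def using xs by (simp add: comp_def prod.distinct_set_conv_list flip: xs(1))
  then have "real_split p" unfolding real_split_def by blast
  then have split: "real_split ((pderiv ^^ m) p)" for m
    by (induction m) (auto intro: real_split_pderiv)
  have at0: "poly ((pderiv ^^ m) p) 0 = complex_of_real (fact m * elem_sym S l m)" for m
    unfolding poly_0_coeff_0 coeff_higher_pderiv
    by (simp add: p_def elem_sym_complex pochhammer_fact[symmetric])
  have sq: "poly (pderiv ((pderiv ^^ j) p)) 0 = complex_of_real (fact (j + 1) * elem_sym S l (j + 1))"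
    "poly (pderiv (pderiv ((pderiv ^^ j) p))) 0 = complex_of_real (fact (j + 2) * elem_sym S l (j + 2))"
    using at0[of "Suc j"] at0[of "Suc (Suc j)"] by simp_all
  obtain v where "v \<ge> 0"
    "complex_of_real ((fact (j + 1) * elem_sym S l (j + 1))\<^sup>2
        - fact j * elem_sym S l j * (fact (j + 2) * elem_sym S l (j + 2))) = complex_of_real v"
    using real_split_laguerre[OF split[of j]] unfolding sq at0 by auto
  then have "0 \<le> (fact (j + 1) * elem_sym S l (j + 1))\<^sup>2
        - fact j * elem_sym S l j * (fact (j + 2) * elem_sym S l (j + 2))"
    by (simp only: of_real_eq_iff)
  also have "\<dots> = fact j * fact (j + 1) *
      (real (j + 1) * (elem_sym S l (j + 1))\<^sup>2 - real (j + 2) * (elem_sym S l j * elem_sym S l (j + 2)))"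
    by (simp add: power2_eq_square algebra_simps)
  finally have "0 \<le> real (j + 1) * (elem_sym S l (j + 1))\<^sup>2 - real (j + 2) * (elem_sym S l j * elem_sym S l (j + 2))"
    by (subst (asm) zero_le_mult_iff) (metis fact_gt_zero mult_pos_pos not_le)
  then show ?thesis by simp
qed (simp add: elem_sym_def)

text \<open>The ratio \<open>(j + 1) / (j + 2)\<close> is less than 1, which leaves room for a
  strict inequality as soon as the square is positive. This strictness is the source of
  ellipticity.\<close>

lemma newton_weak: "elem_sym S l j * elem_sym S l (Suc (Suc j)) \<le> (elem_sym S l (Suc j))\<^sup>2"
  and newton_strict: "elem_sym S l (Suc j) > 0 \<Longrightarrow>
    elem_sym S l j * elem_sym S l (Suc (Suc j)) < (elem_sym S l (Suc j))\<^sup>2"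
proof -
  define X where "X = elem_sym S l j * elem_sym S l (Suc (Suc j))"
  define Y where "Y = (elem_sym S l (Suc j))\<^sup>2"
  have XY: "real (j + 2) * X \<le> real (j + 1) * Y"
    using newton_inequality[of j S l] by (simp add: X_def Y_def)
  have 1: "X \<le> 0" if "Y \<le> X"
  proof -
    have "real (j + 2) * X \<le> real (j + 1) * X"
      by (rule order_trans[OF XY mult_left_mono[OF that]]) simp
    then show ?thesis by (simp add: algebra_simps)
  qed
  have Y: "Y \<ge> 0" by (simp add: Y_def)
  show "elem_sym S l j * elem_sym S l (Suc (Suc j)) \<le> (elem_sym S l (Suc j))\<^sup>2"
    unfolding X_def[symmetric] Y_def[symmetric] using 1 Y by linarith
  assume "elem_sym S l (Suc j) > 0"
  then have "Y > 0" by (simp add: Y_def)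
  with 1 show "elem_sym S l j * elem_sym S l (Suc (Suc j)) < (elem_sym S l (Suc j))\<^sup>2"
    unfolding X_def[symmetric] Y_def[symmetric] by linarith
qed

section \<open>Deleting a variable, and the partial derivatives of the quotient\<close>

lemma elem_sym_remove_pos:
  assumes S: "finite S" "i \<in> S"
    and pos: "\<And>j. 1 \<le> j \<Longrightarrow> j \<le> k \<Longrightarrow> elem_sym S l j > 0"
    and "j < k"
  shows "elem_sym (S - {i}) l j > 0"
  using \<open>j < k\<close>
proof (induction j)
  case (Suc m)
  define T where "T = S - {i}"
  have m: "elem_sym T l m > 0" using Suc by (simp add: T_def)
  show ?case
  proof (rule ccontr)
    assume "\<not> elem_sym (S - {i}) l (Suc m) > 0"
    then have neg: "elem_sym T l (Suc m) \<le> 0" by (simp add: T_def)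
    have "0 < elem_sym T l (Suc m) + l i * elem_sym T l m"
      using pos[of "Suc m"] Suc.prems elem_sym_remove[OF S, of l m] by (simp add: T_def)
    moreover have "0 < elem_sym T l (Suc (Suc m)) + l i * elem_sym T l (Suc m)"
      using pos[of "Suc (Suc m)"] Suc.prems elem_sym_remove[OF S, of l "Suc m"] by (simp add: T_def)
    \<comment> \<open>The weights are chosen so that the terms containing \<open>l i\<close> cancel
      when the two inequalities are added; what remains contradicts Newton for the set
      \<open>T\<close>.\<close>
    ultimately have *: "0 < elem_sym T l m * (elem_sym T l (Suc (Suc m)) + l i * elem_sym T l (Suc m))"
      and **: "0 \<le> (- elem_sym T l (Suc m)) * (elem_sym T l (Suc m) + l i * elem_sym T l m)"
      using m neg by (blast intro: mult_pos_pos mult_nonneg_nonneg less_imp_le neg_0_le_iff_le[THEN iffD2])+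
    have "(elem_sym T l (Suc m))\<^sup>2 < elem_sym T l m * elem_sym T l (Suc (Suc m))"
      using * ** by (simp add: algebra_simps power2_eq_square)
    then show False using newton_weak[of T l m] by simp
  qed
qed simp

lemma quotient_derivative_pos:
  assumes S: "finite S" "i \<in> S"
    and pos: "\<And>j. 1 \<le> j \<Longrightarrow> j \<le> Suc m \<Longrightarrow> elem_sym S l j > 0"
  defines "q \<equiv> \<lambda>j. coeff (pCons 0 (\<Prod>a\<in>S - {i}. [:1, l a:])) j"
  shows "0 < elem_sym S l m * q (Suc m) - q m * elem_sym S l (Suc m)"
    and "elem_sym S l m * q (Suc m) - q m * elem_sym S l (Suc m) \<le> elem_sym S l m * q (Suc m)"
proof -
  define T where "T = S - {i}"
  have T: "elem_sym T l j > 0" if "j \<le> m" for j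
    using elem_sym_remove_pos[OF S pos, of "Suc m" j] that by (auto simp: T_def)
  have q: "q (Suc j) = elem_sym T l j" for j by (simp add: q_def elem_sym_def T_def)
  have Sm: "elem_sym S l (Suc m) > 0" using pos[of "Suc m"] by simp
  show "0 < elem_sym S l m * q (Suc m) - q m * elem_sym S l (Suc m)"
  proof (cases m)
    case 0
    moreover have "q 0 = 0" by (simp add: q_def)
    ultimately show ?thesis by (simp add: q)
  next
    case (Suc r)
    have "elem_sym S l m * q (Suc m) - q m * elem_sym S l (Suc m)
        = (elem_sym T l (Suc r))\<^sup>2 - elem_sym T l r * elem_sym T l (Suc (Suc r))"
      unfolding Suc q elem_sym_remove[OF S, folded T_def] by (simp add: algebra_simps power2_eq_square)
    also have "\<dots> > 0" using newton_strict[of T l r] T[of "Suc r"] Suc by simp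
    finally show ?thesis .
  qed
  have "q m \<ge> 0" using T by (cases m) (auto simp: q intro: less_imp_le, simp add: q_def)
  then show "elem_sym S l m * q (Suc m) - q m * elem_sym S l (Suc m) \<le> elem_sym S l m * q (Suc m)"
    using Sm by simp
qed

lemma sum_elem_sym_remove:
  assumes "finite S"
  shows "(\<Sum>i\<in>S. elem_sym (S - {i}) l m) = (real (card S) - real m) * elem_sym S l m"
proof -
  define p where "p = (\<Prod>i\<in>S. [:1, l i:])"
  define r where "r i = (\<Prod>a\<in>S - {i}. [:1, l a:])" for i
  have "pCons 0 (pderiv p) = (\<Sum>i\<in>S. r i * [:0, l i:])"
  proof -
    have "pCons 0 (pderiv p) = [:0, 1:] * pderiv p" by simp
    also have "\<dots> = (\<Sum>i\<in>S. [:0, 1:] * (r i * [:l i:]))"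
      by (simp add: p_def r_def pderiv_prod pderiv_pCons sum_distrib_left del: mult_pCons_left mult_pCons_right)
    finally show ?thesis by (simp add: mult.commute)
  qed
  also have "\<dots> = (\<Sum>i\<in>S. r i * [:1, l i:] - r i)"
    by (intro sum.cong) (auto simp: algebra_simps)
  also have "\<dots> = (\<Sum>i\<in>S. p - r i)"
    by (intro sum.cong) (auto simp: p_def r_def prod.remove[OF assms] mult.commute)
  finally have "coeff (pCons 0 (pderiv p)) m = (\<Sum>i\<in>S. coeff p m - coeff (r i) m)"
    by (simp add: coeff_sum)
  moreover have "coeff (pCons 0 (pderiv p)) m = m * coeff p m"
    by (cases m) (auto simp: coeff_pderiv)
  ultimately show ?thesis
    by (simp add: sum_subtractf elem_sym_def p_def r_def algebra_simps)
qed

section \<open>Derivatives of the elementary symmetric functions of a Hermitian matrix\<close>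

text \<open>The coefficients of \<open>det (1 + z A)\<close> are the \<open>\<sigma>\<^sub>j\<close> of the spectrum; unlike the eigenvalues they depend
  polynomially on \<open>A\<close>. \<open>dgpoly A B\<close> is the derivative at \<open>A\<close> in direction \<open>B\<close>.\<close>

definition gpoly :: "complex ^ 'n ^ 'n \<Rightarrow> complex poly" where
  "gpoly A = det (\<chi> i j. [:if i = j then 1 else 0, A $ i $ j:])"

definition dgpoly :: "complex ^ 'n ^ 'n \<Rightarrow> complex ^ 'n ^ 'n \<Rightarrow> complex poly" where
  "dgpoly A B = (\<Sum>p | p permutes UNIV. of_int (sign p) *
     (\<Sum>i\<in>UNIV. [:0, B $ i $ p i:] * (\<Prod>l\<in>UNIV - {i}. [:if l = p l then 1 else 0, A $ l $ p l:])))"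

lemma poly_gpoly: "poly (gpoly A) z = det (\<chi> i j. (if i = j then 1 else 0) + z * A $ i $ j)"
  by (simp add: gpoly_def det_def poly_sum poly_prod)

text \<open>For \<open>z\<close> nonzero, \<open>det (1 + z A)\<close> is \<open>(- z)^n\<close>
  times the characteristic polynomial at \<open>- 1 / z\<close>; at \<open>z = 0\<close> both sides
  are 1. Polynomials with equal values agree.\<close>

lemma gpoly_hermitian:
  fixes A :: "complex ^ 'n ^ 'n"
  assumes "hermitian A"
  shows "gpoly A = (\<Prod>i\<in>UNIV. [:1, complex_of_real (eigenvalues A $ i):])"
proof -
  have "poly (gpoly A) z = poly (\<Prod>i\<in>UNIV. [:1, complex_of_real (eigenvalues A $ i):]) z" for z
  proof (cases "z = 0")
    case True
    have "(\<chi> i j. if i = j then 1 else 0) = (mat 1 :: complex ^ 'n ^ 'n)"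
      by (simp add: mat_def)
    with True show ?thesis by (simp add: poly_gpoly poly_prod)
  next
    case False
    have "(\<chi> i j. (if i = j then 1 else 0) + z * A $ i $ j)
        = (\<chi> i. (- z) *s ((mat (- 1 / z) - A) $ i))"
      using False by (simp add: vec_eq_iff mat_def field_simps)
    then have "poly (gpoly A) z = (- z) ^ CARD('n) * det (mat (- 1 / z) - A)"
      unfolding poly_gpoly by (simp only: det_rows_mul prod_constant vec_lambda_eta)
    also have "\<dots> = (- z) ^ CARD('n) * (\<Prod>i\<in>UNIV. - 1 / z - complex_of_real (eigenvalues A $ i))"
      by (simp flip: poly_charpoly add: charpoly_eigenvalues[OF assms] poly_prod algebra_simps)
    also have "\<dots> = (\<Prod>i\<in>UNIV. (- z) * (- 1 / z - complex_of_real (eigenvalues A $ i)))"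
      by (simp only: prod.distrib prod_constant)
    also have "\<dots> = (\<Prod>i\<in>UNIV. 1 + z * complex_of_real (eigenvalues A $ i))"
      using False by (intro prod.cong) (auto simp: field_simps)
    finally show ?thesis by (simp add: poly_prod)
  qed
  then show ?thesis by (simp flip: poly_eq_poly_eq_iff add: fun_eq_iff)
qed

lemma coeff_gpoly_hermitian:
  assumes "hermitian A"
  shows "coeff (gpoly A) j = complex_of_real (esym j (eigenvalues A))"
  unfolding gpoly_hermitian[OF assms] elem_sym_complex esym_eq_elem_sym ..

text \<open>Differentiating each coefficient separately avoids fixing a norm on polynomials.\<close>

definition coeff_has_derivative ::
  "('a::real_normed_vector \<Rightarrow> complex poly) \<Rightarrow> ('a \<Rightarrow> complex poly) \<Rightarrow> 'a \<Rightarrow> bool" where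
  "coeff_has_derivative f f' x \<longleftrightarrow>
     (\<forall>m. ((\<lambda>y. coeff (f y) m) has_derivative (\<lambda>h. coeff (f' h) m)) (at x))"

lemma coeff_has_derivative_mult:
  assumes "coeff_has_derivative f f' x" "coeff_has_derivative g g' x"
  shows "coeff_has_derivative (\<lambda>y. f y * g y) (\<lambda>h. f' h * g x + f x * g' h) x"
  unfolding coeff_has_derivative_def
proof
  fix m
  have "((\<lambda>y. \<Sum>i\<le>m. coeff (f y) i * coeff (g y) (m - i)) has_derivative
      (\<lambda>h. \<Sum>i\<le>m. coeff (f x) i * coeff (g' h) (m - i) + coeff (f' h) i * coeff (g x) (m - i))) (at x)"
    using assms unfolding coeff_has_derivative_def
    by (intro has_derivative_sum has_derivative_mult) auto
  then show "((\<lambda>y. coeff (f y * g y) m) has_derivative (\<lambda>h. coeff (f' h * g x + f x * g' h) m)) (at x)"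
    by (simp add: coeff_mult sum.distrib add.commute)
qed

lemma coeff_has_derivative_const: "coeff_has_derivative (\<lambda>y. c) (\<lambda>h. 0) x"
  unfolding coeff_has_derivative_def by simp

lemma coeff_has_derivative_sum:
  assumes "\<And>i. i \<in> S \<Longrightarrow> coeff_has_derivative (f i) (f' i) x"
  shows "coeff_has_derivative (\<lambda>y. \<Sum>i\<in>S. f i y) (\<lambda>h. \<Sum>i\<in>S. f' i h) x"
  using assms unfolding coeff_has_derivative_def coeff_sum
  by (auto intro!: has_derivative_sum)

lemma coeff_has_derivative_prod:
  assumes "finite S" "\<And>i. i \<in> S \<Longrightarrow> coeff_has_derivative (f i) (f' i) x"
  shows "coeff_has_derivative (\<lambda>y. \<Prod>i\<in>S. f i y) (\<lambda>h. \<Sum>i\<in>S. f' i h * (\<Prod>l\<in>S - {i}. f l x)) x"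
  using assms
proof (induction S)
  case empty
  then show ?case by (simp add: coeff_has_derivative_const)
next
  case (insert a S)
  have eq: "f' a h * (\<Prod>i\<in>S. f i x) + f a x * (\<Sum>i\<in>S. f' i h * (\<Prod>l\<in>S - {i}. f l x))
      = (\<Sum>i\<in>insert a S. f' i h * (\<Prod>l\<in>insert a S - {i}. f l x))" for h
  proof -
    have "f a x * (\<Sum>i\<in>S. f' i h * (\<Prod>l\<in>S - {i}. f l x))
        = (\<Sum>i\<in>S. f' i h * (\<Prod>l\<in>insert a S - {i}. f l x))"
      unfolding sum_distrib_left
    proof (intro sum.cong refl)
      fix i assume "i \<in> S"
      then have "insert a S - {i} = insert a (S - {i})" using insert.hyps by auto
      then show "f a x * (f' i h * (\<Prod>l\<in>S - {i}. f l x)) = f' i h * (\<Prod>l\<in>insert a S - {i}. f l x)"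
        using insert.hyps by (simp add: mult_ac)
    qed
    moreover have "insert a S - {a} = S" using insert.hyps by auto
    ultimately show ?thesis using insert.hyps by simp
  qed
  have "coeff_has_derivative (\<lambda>y. f a y * (\<Prod>i\<in>S. f i y))
      (\<lambda>h. f' a h * (\<Prod>i\<in>S. f i x) + f a x * (\<Sum>i\<in>S. f' i h * (\<Prod>l\<in>S - {i}. f l x))) x"
    by (intro coeff_has_derivative_mult insert.IH insert.prems) auto
  then show ?case unfolding eq using insert.hyps by simp
qed

lemma gpoly_has_derivative:
  fixes A :: "'a::real_normed_vector \<Rightarrow> complex ^ 'n ^ 'n"
  assumes "\<And>i j. ((\<lambda>y. A y $ i $ j) has_derivative (\<lambda>h. A' h $ i $ j)) (at x)"
  shows "((\<lambda>y. coeff (gpoly (A y)) m) has_derivative (\<lambda>h. coeff (dgpoly (A x) (A' h)) m)) (at x)"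
proof -
  have entry: "coeff_has_derivative (\<lambda>y. [:c, A y $ i $ j:]) (\<lambda>h. [:0, A' h $ i $ j:]) x" for c i j
    unfolding coeff_has_derivative_def
  proof
    show "((\<lambda>y. coeff [:c, A y $ i $ j:] m) has_derivative (\<lambda>h. coeff [:0, A' h $ i $ j:] m)) (at x)" for m
      by (cases m; cases "m - 1") (auto simp: assms coeff_pCons)
  qed
  have "coeff_has_derivative (\<lambda>y. gpoly (A y))
      (\<lambda>h. \<Sum>p | p permutes UNIV. 0 * (\<Prod>i\<in>UNIV. [:if i = p i then 1 else 0, A x $ i $ p i:]) +
        of_int (sign p) * (\<Sum>i\<in>UNIV. [:0, A' h $ i $ p i:] *
          (\<Prod>l\<in>UNIV - {i}. [:if l = p l then 1 else 0, A x $ l $ p l:]))) x"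
    unfolding gpoly_def det_def vec_lambda_beta
    by (intro coeff_has_derivative_sum coeff_has_derivative_mult coeff_has_derivative_const
        coeff_has_derivative_prod entry) auto
  then show ?thesis unfolding coeff_has_derivative_def dgpoly_def by simp
qed

lemma dgpoly_add: "dgpoly A (B + C) = dgpoly A B + dgpoly A C"
proof -
  have "[:0, (B + C) $ i $ j:] = [:0, B $ i $ j:] + [:0, C $ i $ j:]" for i j by simp
  then show ?thesis
    unfolding dgpoly_def by (simp only: distrib_right distrib_left sum.distrib)
qed

lemma dgpoly_scaleR: "dgpoly A (r *\<^sub>R B) = smult (of_real r) (dgpoly A B)"
proof -
  have "[:0, (r *\<^sub>R B) $ i $ j:] = [:of_real r:] * [:0, B $ i $ j:]" for i j
    by (simp add: scaleR_conv_of_real[where 'a = complex])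
  then have "dgpoly A (r *\<^sub>R B) = [:of_real r:] * dgpoly A B"
    unfolding dgpoly_def by (simp only: sum_distrib_left mult_ac)
  then show ?thesis by simp
qed

text \<open>A permutation other than the identity moves at least two indices. Differentiation
  removes one factor only, so an off-diagonal zero of \<open>D\<close> survives in every such
  term.\<close>

lemma dgpoly_diagonal:
  fixes D B :: "complex ^ 'n ^ 'n"
  assumes D: "\<And>i j. i \<noteq> j \<Longrightarrow> D $ i $ j = 0"
  shows "dgpoly D B = (\<Sum>i\<in>UNIV. [:0, B $ i $ i:] * (\<Prod>l\<in>UNIV - {i}. [:1, D $ l $ l:]))"
proof -
  define t where "t p = of_int (sign p) * (\<Sum>i\<in>UNIV. [:0, B $ i $ p i:] *
    (\<Prod>l\<in>UNIV - {i}. [:if l = p l then 1 else 0, D $ l $ p l:]))" for p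
  have t0: "t p = 0" if p: "p permutes UNIV" "p \<noteq> id" for p
  proof -
    obtain a where a: "p a \<noteq> a" using p(2) by (auto simp: fun_eq_iff)
    then have pa: "p (p a) \<noteq> p a" using permutes_inj[OF p(1)] by (auto dest: injD)
    have zero: "(\<Prod>l\<in>UNIV - {i}. [:if l = p l then 1 else 0, D $ l $ p l:]) = 0" for i
    proof -
      obtain l where "l \<noteq> i" "p l \<noteq> l" using a pa by metis
      then show ?thesis
        by (intro prod_zero bexI[of _ l]) (auto simp: D)
    qed
    show ?thesis by (simp only: t_def zero mult_zero_right sum.neutral_const)
  qed
  have "dgpoly D B = (\<Sum>p | p permutes UNIV. t p)"
    by (simp add: dgpoly_def t_def)
  also have "\<dots> = t id"
    using sum.mono_neutral_right[of "{p. p permutes UNIV}" "{id}" t] t0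
    by (auto simp: permutes_id finite_permutations)
  finally show ?thesis by (simp add: t_def)
qed

section \<open>Spectral theorem for Hermitian matrices\<close>

definition herm_inner :: "complex ^ 'n \<Rightarrow> complex ^ 'n \<Rightarrow> complex" where
  "herm_inner x y = (\<Sum>i\<in>UNIV. cnj (x $ i) * y $ i)"

lemma Re_herm_inner: "Re (herm_inner x y) = x \<bullet> y"
  by (simp add: herm_inner_def inner_vec_def inner_complex_def)

lemma herm_inner_add: "herm_inner x (y + z) = herm_inner x y + herm_inner x z"
  and herm_inner_scaleR: "herm_inner x (r *\<^sub>R y) = of_real r * herm_inner x y"
  and herm_inner_scaleR_left: "herm_inner (r *\<^sub>R x) y = of_real r * herm_inner x y"
  by (simp_all add: herm_inner_def algebra_simps sum.distrib sum_subtractf sum_distrib_left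
      scaleR_conv_of_real[where 'a = complex])

lemma cnj_herm_inner: "cnj (herm_inner x y) = herm_inner y x"
  by (simp add: herm_inner_def mult.commute)

lemma herm_inner_hermitian:
  assumes "hermitian A"
  shows "herm_inner (A *v x) y = herm_inner x (A *v y)"
proof -
  have "herm_inner (A *v x) y = (\<Sum>i\<in>UNIV. \<Sum>j\<in>UNIV. cnj (x $ j) * (A $ j $ i * y $ i))"
    by (simp add: herm_inner_def matrix_vector_mult_def sum_distrib_right sum_distrib_left mult_ac
        flip: assms[unfolded hermitian_def, rule_format])
  also have "\<dots> = herm_inner x (A *v y)"
    by (subst sum.swap) (simp add: herm_inner_def matrix_vector_mult_def sum_distrib_left)
  finally show ?thesis .
qed

lemma matrix_vector_mult_scaleR_complex:
  "(A :: complex ^ 'n ^ 'm) *v (r *\<^sub>R x) = r *\<^sub>R (A *v x)"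
  by (simp add: vec_eq_iff matrix_vector_mult_def scaleR_sum_right)

lemma linear_coefficient_zero:
  fixes a c :: real
  assumes "\<And>t. 2 * t * a + t\<^sup>2 * c \<ge> 0"
  shows "a = 0"
proof (rule ccontr)
  assume "a \<noteq> 0"
  \<comment> \<open>Since \<open>s\<close> exceeds \<open>c\<close>, the quadratic term cannot
    compensate the linear one at \<open>t = - a / s\<close>.\<close>
  define s where "s = \<bar>c\<bar> + 1"
  define t where "t = - a / s"
  have s: "s > 0" by (simp add: s_def)
  have "t\<^sup>2 * c \<le> t\<^sup>2 * s" by (intro mult_left_mono) (auto simp: s_def)
  also have "\<dots> = - t * a" using s by (simp add: t_def power2_eq_square)
  finally have "0 \<le> t * a" using assms[of t] by simp
  moreover have "t * a = - (a\<^sup>2 / s)" by (simp add: t_def power2_eq_square)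
  moreover have "a\<^sup>2 / s > 0" using s \<open>a \<noteq> 0\<close> by simp
  ultimately show False by simp
qed

text \<open>A maximiser of the Rayleigh quotient on an invariant subspace \<open>W\<close> is an eigenvector.\<close>

lemma hermitian_eigenvector_in:
  fixes A :: "complex ^ 'n ^ 'n" and W :: "(complex ^ 'n) set"
  assumes A: "hermitian A" and W: "subspace W" "closed W"
    and inv: "\<And>x. x \<in> W \<Longrightarrow> A *v x \<in> W" and nz: "v \<in> W" "v \<noteq> 0"
  obtains x and m :: real where "x \<in> W" "norm x = 1" "A *v x = m *\<^sub>R x"
proof -
  define q where "q y = y \<bullet> (A *v y)" for y
  define K where "K = W \<inter> sphere 0 1"
  have "compact K" unfolding K_def using W(2) by (intro closed_Int_compact) auto
  moreover have "(1 / norm v) *\<^sub>R v \<in> K"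
    unfolding K_def using nz W(1) by (auto intro: subspace_scale)
  then have "K \<noteq> {}" by blast
  moreover have "continuous_on K q"
    unfolding q_def matrix_vector_mult_def by (intro continuous_intros)
  ultimately obtain x where x: "x \<in> K" "\<And>y. y \<in> K \<Longrightarrow> q y \<le> q x"
    using continuous_attains_sup by metis
  define m where "m = q x"
  have xW: "x \<in> W" and x1: "norm x = 1" using x(1) by (auto simp: K_def)
  have le: "q y \<le> m * (y \<bullet> y)" if "y \<in> W" for y
  proof (cases "y = 0")
    case True
    then show ?thesis by (simp add: q_def)
  next
    case False
    have "(1 / norm y) *\<^sub>R y \<in> K"
      unfolding K_def using that False W(1) by (auto intro: subspace_scale)
    then have "q ((1 / norm y) *\<^sub>R y) \<le> m" using x(2) by (simp add: m_def)
    also have "q ((1 / norm y) *\<^sub>R y) = q y / (y \<bullet> y)"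
      by (simp add: q_def matrix_vector_mult_scaleR_complex power2_norm_eq_inner[symmetric] power2_eq_square)
    finally show ?thesis using False by (simp add: field_simps)
  qed
  \<comment> \<open>The residual of the eigenvector equation serves as its own test direction: along
    \<open>w\<close> the linear coefficient of the variation is \<open>w . w\<close>, which must
    vanish at a maximum.\<close>
  define w where "w = m *\<^sub>R x - A *v x"
  have wW: "w \<in> W" unfolding w_def using W(1) inv xW by (intro subspace_diff subspace_scale) auto
  have sym: "x \<bullet> (A *v w) = w \<bullet> (A *v x)"
    using arg_cong[OF herm_inner_hermitian[OF A, of x w], of Re] by (simp add: Re_herm_inner inner_commute)
  have "2 * t * (w \<bullet> w) + t\<^sup>2 * (m * (w \<bullet> w) - q w) \<ge> 0" for t
  proof -
    have "x + t *\<^sub>R w \<in> W" using W(1) xW wW by (intro subspace_add subspace_scale)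
    from le[OF this] have "0 \<le> m * ((x + t *\<^sub>R w) \<bullet> (x + t *\<^sub>R w)) - q (x + t *\<^sub>R w)" by simp
    also have "\<dots> = (m * (x \<bullet> x) - q x) + 2 * t * (w \<bullet> (m *\<^sub>R x - A *v x)) + t\<^sup>2 * (m * (w \<bullet> w) - q w)"
      unfolding q_def
      by (simp add: matrix_vector_right_distrib matrix_vector_mult_scaleR_complex inner_add_left
          inner_add_right inner_diff_right sym inner_commute[of x w] power2_eq_square algebra_simps)
    finally show ?thesis using x1 by (simp add: m_def w_def dot_square_norm)
  qed
  then have "w \<bullet> w = 0" by (rule linear_coefficient_zero)
  then have "A *v x = m *\<^sub>R x" by (simp add: w_def)
  with xW x1 that show ?thesis by blast
qed

definition orthonormal_frame :: "('n \<Rightarrow> complex ^ 'n) \<Rightarrow> bool" where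
  "orthonormal_frame e \<longleftrightarrow> (\<forall>i j. herm_inner (e i) (e j) = (if i = j then 1 else 0))"

text \<open>The orthogonal complement of the eigenvectors found so far is invariant under a
  Hermitian matrix, so it contains a further eigenvector as long as it is nonzero.\<close>

lemma hermitian_eigenframe:
  fixes A :: "complex ^ 'n ^ 'n"
  assumes A: "hermitian A"
  obtains e and m :: "'n \<Rightarrow> real" where "orthonormal_frame e" "\<And>i. A *v e i = m i *\<^sub>R e i"
proof -
  have "\<exists>e m. (\<forall>i\<in>I. \<forall>j\<in>I. herm_inner (e i) (e j) = (if i = j then 1 else 0)) \<and>
      (\<forall>i\<in>I. A *v e i = (m i :: real) *\<^sub>R e i)" if "finite I" for I :: "'n set"
    using that
  proof (induction I)
    case (insert a I)
    obtain e m where e: "\<And>i j. i \<in> I \<Longrightarrow> j \<in> I \<Longrightarrow> herm_inner (e i) (e j) = (if i = j then 1 else 0)"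
      "\<And>i. i \<in> I \<Longrightarrow> A *v e i = (m i :: real) *\<^sub>R e i"
      using insert.IH by blast
    define W where "W = {y. \<forall>i\<in>I. herm_inner (e i) y = 0}"
    \<comment> \<open>The kernel of \<open>M\<close> is the complement \<open>W\<close>. The row
      with index \<open>a\<close> is zero, so \<open>M\<close> is singular and \<open>W\<close>
      contains a nonzero vector.\<close>
    define M :: "complex ^ 'n ^ 'n" where "M = (\<chi> i. if i \<in> I then (\<chi> l. cnj (e i $ l)) else 0)"
    have "row a M = 0" using insert.hyps by (simp add: M_def row_def vec_eq_iff)
    then have "det M = 0" by (rule det_zero_row)
    then have "\<not> invertible M" by (simp add: invertible_det_nz)
    then obtain v where v: "M *v v = 0" "v \<noteq> 0"
      by (auto simp: invertible_left_inverse matrix_left_invertible_ker)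
    have "v \<in> W"
    proof -
      have "herm_inner (e i) v = (M *v v) $ i" if "i \<in> I" for i
        using that by (simp add: M_def herm_inner_def matrix_vector_mult_def)
      with v(1) show ?thesis by (simp add: W_def)
    qed
    moreover have "subspace W"
      by (auto simp: subspace_def W_def herm_inner_add herm_inner_scaleR) (simp add: herm_inner_def)
    moreover have "closed W"
    proof -
      have "closed {y. herm_inner (e i) y = 0}" for i
        unfolding herm_inner_def by (intro closed_Collect_eq continuous_intros)
      moreover have "W = (\<Inter>i\<in>I. {y. herm_inner (e i) y = 0})" by (auto simp: W_def)
      ultimately show ?thesis by auto
    qed
    moreover have "A *v x \<in> W" if "x \<in> W" for x
      using that e(2) by (simp add: W_def herm_inner_scaleR_left flip: herm_inner_hermitian[OF A])
    ultimately obtain x mu where x: "x \<in> W" "norm x = 1" "A *v x = (mu :: real) *\<^sub>R x"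
      using hermitian_eigenvector_in[OF A] v(2) by metis
    have xx: "herm_inner x x = 1"
    proof -
      have "Im (herm_inner x x) = 0" using arg_cong[OF cnj_herm_inner[of x x], of Im] by simp
      then show ?thesis using x(2) by (simp add: complex_eq_iff Re_herm_inner dot_square_norm)
    qed
    have ex: "herm_inner (e i) x = 0" "herm_inner x (e i) = 0" if "i \<in> I" for i
      using that x(1) cnj_herm_inner[of "e i" x] by (auto simp: W_def)
    show ?case
      using insert.hyps e x(3) xx ex
      by (intro exI[of _ "e(a := x)"] exI[of _ "m(a := mu)"]) auto
  qed simp
  from this[of UNIV] have "\<exists>(e :: 'n \<Rightarrow> complex ^ 'n) m. (\<forall>i j. herm_inner (e i) (e j) = (if i = j then 1 else 0)) \<and>
      (\<forall>i. A *v e i = (m i :: real) *\<^sub>R e i)"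
    by (simp split del: if_split)
  then obtain e :: "'n \<Rightarrow> complex ^ 'n" and m where
    "\<forall>i j. herm_inner (e i) (e j) = (if i = j then 1 else 0)" "\<forall>i. A *v e i = (m i :: real) *\<^sub>R e i"
    by blast
  with that show ?thesis by (auto simp: orthonormal_frame_def)
qed

section \<open>Unitary invariance and ellipticity of the linearised quotient\<close>

definition in_frame :: "('n \<Rightarrow> complex ^ 'n) \<Rightarrow> complex ^ 'n ^ 'n \<Rightarrow> complex ^ 'n ^ 'n" where
  "in_frame e B = (\<chi> i j. herm_inner (e i) (B *v e j))"

lemma det_in_frame:
  fixes B :: "complex ^ 'n ^ 'n"
  assumes "orthonormal_frame e"
  shows "det (in_frame e B) = det B"
proof -
  define U V :: "complex ^ 'n ^ 'n" where "U = (\<chi> l j. e j $ l)" and "V = (\<chi> i l. cnj (e i $ l))"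
  have "V ** (B ** U) = in_frame e B"
    by (simp add: in_frame_def V_def U_def matrix_matrix_mult_def herm_inner_def matrix_vector_mult_def vec_eq_iff)
  moreover have "V ** U = mat 1"
    using assms by (simp add: orthonormal_frame_def V_def U_def matrix_matrix_mult_def herm_inner_def mat_def vec_eq_iff)
  then have "det V * det U = 1" by (metis det_I det_mul)
  ultimately show ?thesis by (metis det_mul mult.assoc mult.commute mult.left_neutral)
qed

lemma gpoly_in_frame:
  fixes B :: "complex ^ 'n ^ 'n"
  assumes "orthonormal_frame e"
  shows "gpoly (in_frame e B) = gpoly B"
proof -
  have "poly (gpoly (in_frame e B)) z = poly (gpoly B) z" for z
  proof -
    define M :: "complex ^ 'n ^ 'n" where "M = (\<chi> i j. (if i = j then 1 else 0) + z * B $ i $ j)"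
    have M: "M *v y = y + z *s (B *v y)" for y
      by (simp add: M_def vec_eq_iff matrix_vector_mult_def distrib_right sum.distrib
          sum_distrib_left mult.assoc if_distrib[of "\<lambda>x. x * _"] cong: if_cong)
    have "herm_inner x (y + z *s w) = herm_inner x y + z * herm_inner x w" for x y w :: "complex ^ 'n"
      by (simp add: herm_inner_def sum.distrib sum_distrib_left algebra_simps)
    then have "(\<chi> i j. (if i = j then 1 else 0) + z * in_frame e B $ i $ j) = in_frame e M"
      using assms by (simp add: in_frame_def M orthonormal_frame_def vec_eq_iff)
    then show ?thesis by (simp add: poly_gpoly det_in_frame[OF assms] flip: M_def)
  qed
  then show ?thesis by (simp flip: poly_eq_poly_eq_iff add: fun_eq_iff)
qed

text \<open>A derivative inherits invariance: along the line \<open>A + t B\<close> the function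
  \<open>gpoly\<close> is the same in both frames, and its derivative at \<open>t = 0\<close> is
  unique.\<close>

lemma dgpoly_in_frame:
  fixes A B :: "complex ^ 'n ^ 'n"
  assumes e: "orthonormal_frame e"
  shows "dgpoly (in_frame e A) (in_frame e B) = dgpoly A B"
proof (rule poly_eqI)
  fix m
  have lin: "in_frame e (A + t *\<^sub>R B) $ i $ j = in_frame e A $ i $ j + t *\<^sub>R (in_frame e B $ i $ j)"
    for t :: real and i j
  proof -
    have "(A + t *\<^sub>R B) *v y = A *v y + t *\<^sub>R (B *v y)" for y
      by (simp add: vec_eq_iff matrix_vector_mult_def algebra_simps sum.distrib scaleR_sum_right)
    then show ?thesis by (simp add: in_frame_def herm_inner_add herm_inner_scaleR scaleR_conv_of_real[where 'a = complex])
  qed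
  have 1: "((\<lambda>t. coeff (gpoly (A + t *\<^sub>R B)) m) has_derivative
      (\<lambda>h. coeff (dgpoly (A + 0 *\<^sub>R B) (h *\<^sub>R B)) m)) (at (0::real))"
    by (rule gpoly_has_derivative) (auto intro!: derivative_eq_intros)
  have 2: "((\<lambda>t. coeff (gpoly (in_frame e (A + t *\<^sub>R B))) m) has_derivative
      (\<lambda>h. coeff (dgpoly (in_frame e (A + 0 *\<^sub>R B)) (h *\<^sub>R in_frame e B)) m)) (at (0::real))"
    by (rule gpoly_has_derivative) (auto simp: lin intro!: derivative_eq_intros)
  from has_derivative_unique[OF 1 2[unfolded gpoly_in_frame[OF e]]]
  have "coeff (dgpoly A (h *\<^sub>R B)) m = coeff (dgpoly (in_frame e A) (h *\<^sub>R in_frame e B)) m" for h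
    by (simp add: fun_eq_iff)
  from this[of 1] show "coeff (dgpoly (in_frame e A) (in_frame e B)) m = coeff (dgpoly A B) m"
    by simp
qed

text \<open>The derivative of \<open>- \<sigma>\<^sub>k\<^sub>-\<^sub>1 / \<sigma>\<^sub>k\<close> at \<open>A\<close> in direction \<open>B\<close>.\<close>

definition quot_deriv :: "nat \<Rightarrow> complex ^ 'n ^ 'n \<Rightarrow> complex ^ 'n ^ 'n \<Rightarrow> real" where
  "quot_deriv k A B = (Re (coeff (gpoly A) (k - 1)) * Re (coeff (dgpoly A B) k)
     - Re (coeff (dgpoly A B) (k - 1)) * Re (coeff (gpoly A) k)) / (Re (coeff (gpoly A) k))\<^sup>2"

lemma quot_deriv_add: "quot_deriv k A (B + C) = quot_deriv k A B + quot_deriv k A C"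
  and quot_deriv_scaleR: "quot_deriv k A (r *\<^sub>R B) = r * quot_deriv k A B"
  by (simp_all add: quot_deriv_def dgpoly_add dgpoly_scaleR algebra_simps add_divide_distrib diff_divide_distrib)

lemma quot_deriv_diff: "quot_deriv k A (B - C) = quot_deriv k A B - quot_deriv k A C"
  using quot_deriv_add[of k A B "- C"] quot_deriv_scaleR[of k A "-1" C] by simp

text \<open>In an eigenframe of \<open>A\<close> only the diagonal entries of \<open>B\<close>
  contribute, with weights \<open>c i\<close> equal to the derivatives of minus the quotient in the
  eigenvalues.\<close>

lemma quot_deriv_frame:
  fixes A :: "complex ^ 'n ^ 'n"
  assumes A: "hermitian A" and k: "1 \<le> k" and G: "eigenvalues A \<in> Gamma_cone k"
  obtains e and c :: "'n \<Rightarrow> real" where "orthonormal_frame e" "\<And>i. c i > 0"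
    "\<And>B. quot_deriv k A B = (\<Sum>i\<in>UNIV. c i * Re (herm_inner (e i) (B *v e i)))"
    "sum c UNIV \<le> real CARD('n) * (esym (k - 1) (eigenvalues A) / esym k (eigenvalues A))\<^sup>2"
proof -
  obtain m where m: "k = Suc m" using k by (cases k) auto
  obtain e and l :: "'n \<Rightarrow> real" where e: "orthonormal_frame e" and l: "\<And>i. A *v e i = l i *\<^sub>R e i"
    using hermitian_eigenframe[OF A] by blast
  define D where "D = in_frame e A"
  have D: "D $ i $ j = (if i = j then complex_of_real (l i) else 0)" for i j
    using e by (simp add: D_def in_frame_def l herm_inner_scaleR orthonormal_frame_def)
  have "gpoly A = gpoly D" by (simp add: D_def gpoly_in_frame[OF e])
  also have "gpoly D = (\<Prod>i\<in>UNIV. [:1, complex_of_real (l i):])"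
    unfolding gpoly_def by (subst det_diagonal) (auto simp: D)
  finally have gA: "coeff (gpoly A) j = complex_of_real (elem_sym UNIV l j)" for j
    by (simp add: elem_sym_complex)
  \<comment> \<open>The frame eigenvalues \<open>l\<close> and the chosen list
    \<open>eigenvalues A\<close> may be ordered differently; they are compared through their
    symmetric functions alone.\<close>
  then have es: "esym j (eigenvalues A) = elem_sym UNIV l j" for j
    using coeff_gpoly_hermitian[OF A, of j] by simp
  have pos: "elem_sym UNIV l j > 0" if "1 \<le> j" "j \<le> Suc m" for j
    using G that by (simp add: Gamma_cone_def m flip: es)
  define q where "q i j = coeff (pCons 0 (\<Prod>a\<in>UNIV - {i}. [:1, l a:])) j" for i j
  have qc: "coeff (pCons 0 (\<Prod>a\<in>UNIV - {i}. [:1, complex_of_real (l a):])) j = complex_of_real (q i j)"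
    for i j
    unfolding q_def by (cases j) (auto simp: elem_sym_complex simp flip: elem_sym_def)
  have dA: "Re (coeff (dgpoly A B) j) = (\<Sum>i\<in>UNIV. Re (herm_inner (e i) (B *v e i)) * q i j)" for B j
  proof -
    have "dgpoly A B = (\<Sum>i\<in>UNIV. [:0, in_frame e B $ i $ i:] * (\<Prod>a\<in>UNIV - {i}. [:1, D $ a $ a:]))"
      unfolding dgpoly_in_frame[OF e, of A B, symmetric] D_def[symmetric]
      by (rule dgpoly_diagonal) (simp add: D)
    also have "\<dots> = (\<Sum>i\<in>UNIV. smult (herm_inner (e i) (B *v e i))
        (pCons 0 (\<Prod>a\<in>UNIV - {i}. [:1, complex_of_real (l a):])))"
      by (simp add: in_frame_def D)
    finally show ?thesis by (simp add: coeff_sum qc del: coeff_pCons_Suc smult_pCons)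
  qed
  define E where "E = elem_sym UNIV l"
  define c where "c i = (E m * q i (Suc m) - q i m * E (Suc m)) / (E (Suc m))\<^sup>2" for i
  have Epos: "E (Suc m) > 0" using pos by (simp add: E_def)
  have c: "c i > 0" "c i \<le> E m * q i (Suc m) / (E (Suc m))\<^sup>2" for i
    using quotient_derivative_pos[where S = UNIV and i = i and m = m and l = l, OF _ _ pos] Epos
    by (auto simp: c_def q_def E_def intro!: divide_right_mono divide_pos_pos)
  have "quot_deriv k A B = (\<Sum>i\<in>UNIV. c i * Re (herm_inner (e i) (B *v e i)))" for B
    unfolding quot_deriv_def c_def m dA gA
    by (simp add: E_def sum_distrib_left sum_distrib_right sum_divide_distrib sum_subtractf[symmetric] algebra_simps)
  moreover have "sum c UNIV \<le> real CARD('n) * (E m / E (Suc m))\<^sup>2"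
  proof -
    have "E m \<ge> 0" using pos[of m] by (cases m) (auto simp: E_def)
    have "sum c UNIV \<le> (\<Sum>i\<in>UNIV. E m * q i (Suc m) / (E (Suc m))\<^sup>2)"
      by (intro sum_mono c)
    also have "\<dots> = E m * (\<Sum>i\<in>UNIV. elem_sym (UNIV - {i}) l m) / (E (Suc m))\<^sup>2"
      by (simp add: q_def elem_sym_def sum_distrib_left sum_divide_distrib)
    also have "\<dots> = (real CARD('n) - real m) * (E m / E (Suc m))\<^sup>2"
      by (simp add: sum_elem_sym_remove E_def power2_eq_square)
    also have "\<dots> \<le> real CARD('n) * (E m / E (Suc m))\<^sup>2"
      by (intro mult_right_mono) auto
    finally show ?thesis .
  qed
  ultimately show ?thesis using that[OF e c(1)] by (simp add: es m E_def)
qed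

section \<open>Directional derivatives\<close>

definition dird :: "'a::euclidean_space \<Rightarrow> ('a \<Rightarrow> real) \<Rightarrow> 'a \<Rightarrow> real" where
  "dird v u x = frechet_derivative u (at x) v"

lemma smooth_has_derivative:
  assumes "smooth u"
  shows "(u has_derivative (\<lambda>v. dird v u x)) (at x)"
proof -
  have "C_k_fun (Suc 0) u" using assms by (simp only: smooth_def)
  then show ?thesis unfolding dird_def by (simp add: frechet_derivative_works eta_contract_eq)
qed

lemma dird_eqI: "(u has_derivative u') (at x) \<Longrightarrow> dird v u x = u' v"
  unfolding dird_def using frechet_derivative_at by metis

lemma smooth_dird:
  assumes "smooth u"
  shows "smooth (dird v u)"
  unfolding smooth_def
proof
  fix m
  have "C_k_fun (Suc m) u" using assms by (simp only: smooth_def)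
  then show "C_k_fun m (dird v u)" by (simp add: dird_def[abs_def])
qed

lemma smooth_continuous: "smooth u \<Longrightarrow> continuous_on S u"
  by (metis C_k_fun.simps(1) continuous_on_subset smooth_def subset_UNIV)

lemma dird_add_left:
  assumes "smooth u"
  shows "dird (v + w) u = (\<lambda>x. dird v u x + dird w u x)"
  using linear_add[OF has_derivative_linear[OF smooth_has_derivative[OF assms]]] by auto

lemma dird_scaleR_left:
  assumes "smooth u"
  shows "dird (r *\<^sub>R v) u = (\<lambda>x. r * dird v u x)"
  using linear_scale[OF has_derivative_linear[OF smooth_has_derivative[OF assms]]] by auto

lemma dird_plus:
  assumes "smooth f" "smooth g"
  shows "dird v (\<lambda>x. f x + g x) = (\<lambda>x. dird v f x + dird v g x)"
  using has_derivative_add[OF smooth_has_derivative[OF assms(1)] smooth_has_derivative[OF assms(2)]]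
  by (auto intro!: dird_eqI)

lemma dird_cmult:
  assumes "smooth f"
  shows "dird v (\<lambda>x. r * f x) = (\<lambda>x. r * dird v f x)"
  using has_derivative_mult_right[OF smooth_has_derivative[OF assms], of r]
  by (auto intro!: dird_eqI)

lemma has_derivative_along_line:
  fixes v :: "'a::real_normed_vector"
  assumes "\<And>x. (u has_derivative (\<lambda>v. u' v x)) (at x)"
  shows "((\<lambda>s. u (a + s *\<^sub>R v)) has_real_derivative u' v (a + s *\<^sub>R v)) (at s)"
proof -
  have "((\<lambda>s. u (a + s *\<^sub>R v)) has_derivative (\<lambda>h. u' (h *\<^sub>R v) (a + s *\<^sub>R v))) (at s)"
    by (rule has_derivative_compose[OF _ assms]) (auto intro!: derivative_eq_intros)
  moreover have "u' (h *\<^sub>R v) (a + s *\<^sub>R v) = u' v (a + s *\<^sub>R v) * h" for h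
    using linear_scale[OF has_derivative_linear[OF assms]] by (auto simp: mult.commute)
  ultimately show ?thesis by (simp add: has_field_derivative_def)
qed

text \<open>The mean value theorem is applied in direction \<open>v\<close> and then in direction
  \<open>w\<close>. The left-hand side is symmetric in \<open>v\<close> and \<open>w\<close>, which
  will identify the mixed derivatives.\<close>

lemma smooth_second_difference:
  assumes u: "smooth u" and h: "h > 0"
  shows "\<exists>s t. 0 < s \<and> s < h \<and> 0 < t \<and> t < h \<and>
    u (x + h *\<^sub>R v + h *\<^sub>R w) - u (x + h *\<^sub>R v) - u (x + h *\<^sub>R w) + u x
      = h\<^sup>2 * dird w (dird v u) (x + s *\<^sub>R v + t *\<^sub>R w)"
proof -
  note line = has_derivative_along_line[OF smooth_has_derivative]
  have "((\<lambda>s. u (x + h *\<^sub>R w + s *\<^sub>R v) - u (x + s *\<^sub>R v)) has_real_derivative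
      dird v u (x + h *\<^sub>R w + s *\<^sub>R v) - dird v u (x + s *\<^sub>R v)) (at s)" for s
    by (intro DERIV_diff line u)
  from MVT2[OF h this] obtain s where s: "0 < s" "s < h"
    "u (x + h *\<^sub>R w + h *\<^sub>R v) - u (x + h *\<^sub>R v) - (u (x + h *\<^sub>R w) - u x)
      = h * (dird v u (x + h *\<^sub>R w + s *\<^sub>R v) - dird v u (x + s *\<^sub>R v))"
    by auto
  have "((\<lambda>t. dird v u (x + s *\<^sub>R v + t *\<^sub>R w)) has_real_derivative
      dird w (dird v u) (x + s *\<^sub>R v + t *\<^sub>R w)) (at t)" for t
    by (intro line smooth_dird u)
  from MVT2[OF h this] obtain t where t: "0 < t" "t < h"
    "dird v u (x + s *\<^sub>R v + h *\<^sub>R w) - dird v u (x + s *\<^sub>R v)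
      = h * dird w (dird v u) (x + s *\<^sub>R v + t *\<^sub>R w)"
    by auto
  have "u (x + h *\<^sub>R v + h *\<^sub>R w) - u (x + h *\<^sub>R v) - u (x + h *\<^sub>R w) + u x
      = h * (h * dird w (dird v u) (x + s *\<^sub>R v + t *\<^sub>R w))"
    unfolding t(3)[symmetric] using s(3) by (simp add: add_ac)
  with s t show ?thesis by (auto simp: power2_eq_square)
qed

lemma dird_commute:
  assumes u: "smooth u"
  shows "dird v (dird w u) = dird w (dird v u)"
proof (rule ext, rule ccontr)
  fix x
  define f g where "f = dird v (dird w u)" and "g = dird w (dird v u)"
  assume "dird v (dird w u) x \<noteq> dird w (dird v u) x"
  then have d: "\<bar>f x - g x\<bar> / 2 > 0" by (simp add: f_def g_def)
  have "continuous (at x) f" "continuous (at x) g"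
    unfolding f_def g_def
    using smooth_continuous[OF smooth_dird[OF smooth_dird[OF u]], of UNIV]
    by (auto simp: continuous_on_eq_continuous_at)
  then obtain d1 d2 where d12: "d1 > 0" "d2 > 0"
    "\<And>y. dist y x < d1 \<Longrightarrow> dist (f y) (f x) < \<bar>f x - g x\<bar> / 2"
    "\<And>y. dist y x < d2 \<Longrightarrow> dist (g y) (g x) < \<bar>f x - g x\<bar> / 2"
    using d unfolding continuous_at_eps_delta by metis
  \<comment> \<open>With this step size the intermediate points of both second differences lie in
    the two continuity neighbourhoods of \<open>x\<close>.\<close>
  define h where "h = min d1 d2 / (norm v + norm w + 1)"
  have nvw: "norm v + norm w + 1 > 0" by (simp add: add_nonneg_pos)
  have h: "h > 0" using d12 nvw by (simp add: h_def)
  have near: "dist (x + s *\<^sub>R v + t *\<^sub>R w) x < min d1 d2"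
    if "0 < s" "s < h" "0 < t" "t < h" for s t
  proof -
    have "dist (x + s *\<^sub>R v + t *\<^sub>R w) x \<le> norm (s *\<^sub>R v) + norm (t *\<^sub>R w)"
      by (simp add: dist_norm norm_triangle_ineq del: norm_scaleR)
    also have "\<dots> \<le> h * norm v + h * norm w"
      using that by (auto intro!: add_mono mult_right_mono)
    also have "\<dots> < h * (norm v + norm w + 1)" using h by (simp add: algebra_simps)
    also have "\<dots> = min d1 d2" using nvw by (simp add: h_def)
    finally show ?thesis .
  qed
  obtain s t where st: "0 < s" "s < h" "0 < t" "t < h"
    "u (x + h *\<^sub>R v + h *\<^sub>R w) - u (x + h *\<^sub>R v) - u (x + h *\<^sub>R w) + u x
      = h\<^sup>2 * g (x + s *\<^sub>R v + t *\<^sub>R w)"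
    using smooth_second_difference[OF u h, of x v w] unfolding g_def by blast
  obtain s' t' where st': "0 < s'" "s' < h" "0 < t'" "t' < h"
    "u (x + h *\<^sub>R w + h *\<^sub>R v) - u (x + h *\<^sub>R w) - u (x + h *\<^sub>R v) + u x
      = h\<^sup>2 * f (x + s' *\<^sub>R w + t' *\<^sub>R v)"
    using smooth_second_difference[OF u h, of x w v] unfolding f_def by blast
  have "h\<^sup>2 * g (x + s *\<^sub>R v + t *\<^sub>R w) = h\<^sup>2 * f (x + t' *\<^sub>R v + s' *\<^sub>R w)"
  proof -
    have "x + h *\<^sub>R w + h *\<^sub>R v = x + h *\<^sub>R v + h *\<^sub>R w"
      "x + s' *\<^sub>R w + t' *\<^sub>R v = x + t' *\<^sub>R v + s' *\<^sub>R w" by (simp_all add: add_ac)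
    with st'(5) have "u (x + h *\<^sub>R v + h *\<^sub>R w) - u (x + h *\<^sub>R w) - u (x + h *\<^sub>R v) + u x
        = h\<^sup>2 * f (x + t' *\<^sub>R v + s' *\<^sub>R w)" by simp
    with st(5) show ?thesis by linarith
  qed
  then have "g (x + s *\<^sub>R v + t *\<^sub>R w) = f (x + t' *\<^sub>R v + s' *\<^sub>R w)" using h by simp
  moreover have "\<bar>f (x + t' *\<^sub>R v + s' *\<^sub>R w) - f x\<bar> < \<bar>f x - g x\<bar> / 2"
    using d12(3) near st' by (simp add: dist_real_def)
  moreover have "\<bar>g (x + s *\<^sub>R v + t *\<^sub>R w) - g x\<bar> < \<bar>f x - g x\<bar> / 2"
    using d12(4) near st by (simp add: dist_real_def)
  ultimately show False by (smt (verit) field_sum_of_halves)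
qed

lemma bilinear_second_dird:
  assumes "smooth u"
  shows "bilinear (\<lambda>v w. dird v (dird w u) x)"
proof -
  have 1: "linear (\<lambda>v. dird v (dird w u) x)" for w
    by (rule has_derivative_linear[OF smooth_has_derivative[OF smooth_dird[OF assms]]])
  have "linear (\<lambda>w. dird v (dird w u) x)" for v
    unfolding dird_commute[OF assms, of v] by (rule 1)
  with 1 show ?thesis by (simp add: bilinear_def)
qed

lemma bilinear_third_dird:
  assumes "smooth u"
  shows "bilinear (\<lambda>v w. dird a (dird v (dird w u)) x)"
proof -
  note sm = smooth_dird[OF smooth_dird[OF assms]] smooth_dird[OF assms]
  have 1: "linear (\<lambda>v. dird a (dird v (dird w u)) x)" for w
    by (intro linearI) (simp_all add: dird_add_left dird_scaleR_left dird_plus dird_cmult sm)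
  have "linear (\<lambda>w. dird a (dird v (dird w u)) x)" for v
    unfolding dird_commute[OF assms, of v] by (rule 1)
  with 1 show ?thesis by (simp add: bilinear_def)
qed

text \<open>The point \<open>x\<close> is both base point and direction. Expanding the direction in
  the basis separates the two roles and reduces the claim to the product rule.\<close>

lemma euler_has_derivative:
  assumes g: "smooth g"
  shows "((\<lambda>x. dird x g x) has_derivative (\<lambda>v. dird v g x + dird x (dird v g) x)) (at x)"
proof -
  have rep: "dird v f x = (\<Sum>b\<in>Basis. (v \<bullet> b) * dird b f x)" if "smooth f" for v f x
  proof -
    have lin: "linear (\<lambda>v. dird v f x)"
      by (rule has_derivative_linear[OF smooth_has_derivative[OF that]])
    have "dird v f x = dird (\<Sum>b\<in>Basis. (v \<bullet> b) *\<^sub>R b) f x" by (simp add: euclidean_representation)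
    also have "\<dots> = (\<Sum>b\<in>Basis. (v \<bullet> b) * dird b f x)"
      using linear_sum[OF lin, of "\<lambda>b. (v \<bullet> b) *\<^sub>R b" Basis] linear_scale[OF lin] by simp
    finally show ?thesis .
  qed
  have "((\<lambda>x. \<Sum>b\<in>Basis. (x \<bullet> b) * dird b g x) has_derivative
      (\<lambda>v. \<Sum>b\<in>Basis. (x \<bullet> b) * dird v (dird b g) x + (v \<bullet> b) * dird b g x)) (at x)"
    by (intro has_derivative_sum has_derivative_mult smooth_has_derivative smooth_dird g)
      (auto intro!: derivative_eq_intros)
  moreover have "(\<Sum>b\<in>Basis. (x \<bullet> b) * dird v (dird b g) x + (v \<bullet> b) * dird b g x)
      = dird v g x + dird x (dird v g) x" for v
    unfolding rep[OF g, of v x] rep[OF smooth_dird[OF g], of x v x]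
    by (simp only: sum.distrib dird_commute[OF g, of v] add.commute)
  moreover have "(\<lambda>x. \<Sum>b\<in>Basis. (x \<bullet> b) * dird b g x) = (\<lambda>x. dird x g x)"
    by (rule ext) (rule rep[OF g, symmetric])
  ultimately show ?thesis by (simp only:)
qed

lemma second_derivative_test:
  fixes f :: "real \<Rightarrow> real"
  assumes f: "\<And>t. (f has_real_derivative f' t) (at t)" and f': "(f' has_real_derivative d) (at 0)"
    and 0: "f' 0 = 0" and min: "\<And>t. f 0 \<le> f t"
  shows "d \<ge> 0"
proof (rule ccontr)
  assume "\<not> d \<ge> 0"
  then have "d < 0" by simp
  from DERIV_neg_dec_right[OF f' this] obtain e where e: "e > 0" "\<forall>h>0. h < e \<longrightarrow> f' (0 + h) < f' 0"
    by blast
  have e2: "0 < e / 2" using e(1) by simp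
  obtain z where z: "0 < z" "z < e / 2" "f (e / 2) - f 0 = (e / 2 - 0) * f' z"
    using MVT2[OF e2 f] by blast
  have "z < e" using z(2) e2 by linarith
  with e(2) z(1) 0 have "f' z < 0" by simp
  then have "(e / 2 - 0) * f' z < 0" using e2 by (intro mult_pos_neg) simp_all
  with z(3) min[of "e / 2"] show False by linarith
qed

section \<open>The complex Hessian in terms of real second derivatives\<close>

text \<open>The Hermitian matrix \<open>\<partial>\<^sub>i \<partial>\<^sub>j\<close> (second index conjugated) built from a real second derivative \<open>S\<close>.\<close>

definition hess_form :: "(complex ^ 'n \<Rightarrow> complex ^ 'n \<Rightarrow> real) \<Rightarrow> complex ^ 'n ^ 'n" where
  "hess_form S = (\<chi> i j. (1 / 4) * Complex
     (S (axis i 1) (axis j 1) + S (axis i \<i>) (axis j \<i>))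
     (S (axis i 1) (axis j \<i>) - S (axis i \<i>) (axis j 1)))"

lemma complex_hessian_eq_hess_form:
  fixes u :: "complex ^ 'n \<Rightarrow> real"
  assumes u: "smooth u"
  shows "complex_hessian u z = hess_form (\<lambda>v w. dird v (dird w u) z)"
proof -
  have cd: "frechet_derivative (\<lambda>w. complex_of_real (f w)) (at z) v = complex_of_real (dird v f z)"
    if "smooth f" for f :: "complex ^ 'n \<Rightarrow> real" and z v
    by (rule frechet_derivative_at[THEN fun_cong, symmetric])
      (intro has_derivative_of_real smooth_has_derivative that)
  have zbar: "partial_zbar j (\<lambda>w. complex_of_real (u w)) = (\<lambda>w. (1/2) *
      (complex_of_real (dird (axis j 1) u w) + \<i> * complex_of_real (dird (axis j \<i>) u w)))" for j
    by (simp add: fun_eq_iff partial_zbar_def partial_x_def partial_y_def cd[OF u])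
  have fd: "frechet_derivative (partial_zbar j (\<lambda>w. complex_of_real (u w))) (at z) v = (1/2) *
      (complex_of_real (dird v (dird (axis j 1) u) z) + \<i> * complex_of_real (dird v (dird (axis j \<i>) u) z))"
    for j v
    unfolding zbar
    by (rule frechet_derivative_at[THEN fun_cong, symmetric])
      (intro has_derivative_mult_right has_derivative_add has_derivative_of_real
        smooth_has_derivative smooth_dird u)
  show ?thesis
    by (simp add: complex_hessian_def hess_form_def partial_z_def partial_x_def partial_y_def vec_eq_iff fd)
      (simp add: complex_eq_iff field_simps)
qed

lemma hess_form_diff: "hess_form (\<lambda>v w. S v w - T v w) = hess_form S - hess_form T"
  and hess_form_cmult: "hess_form (\<lambda>v w. r * S v w) = r *\<^sub>R hess_form S"
  by (simp_all add: hess_form_def vec_eq_iff complex_eq_iff field_simps)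

lemma hermitian_hess_form:
  assumes "\<And>v w. S v w = S w v"
  shows "hermitian (hess_form S)"
  unfolding hermitian_def
proof (intro allI)
  fix i j
  show "hess_form S $ j $ i = cnj (hess_form S $ i $ j)"
    using assms[of "axis j 1" "axis i 1"] assms[of "axis j \<i>" "axis i \<i>"]
      assms[of "axis j 1" "axis i \<i>"] assms[of "axis j \<i>" "axis i 1"]
    by (simp add: hess_form_def complex_eq_iff)
qed

text \<open>The form \<open>2 * (v . w)\<close> is the real Hessian of the squared norm, whose
  complex Hessian is the identity.\<close>

lemma hess_form_inner: "hess_form (\<lambda>v w. 2 * (v \<bullet> w)) = mat 1"
  by (simp add: hess_form_def mat_def vec_eq_iff inner_axis_axis complex_eq_iff inner_complex_def)

definition cnj_vec :: "complex ^ 'n \<Rightarrow> complex ^ 'n" where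
  "cnj_vec e = (\<chi> i. cnj (e $ i))"

definition rot_vec :: "complex ^ 'n \<Rightarrow> complex ^ 'n" where
  "rot_vec e = (\<chi> i. \<i> * e $ i)"

lemma bilinear_expand:
  fixes S :: "complex ^ 'n \<Rightarrow> complex ^ 'n \<Rightarrow> real"
  assumes S: "bilinear S"
  shows "S v w = (\<Sum>i\<in>UNIV. \<Sum>j\<in>UNIV.
     Re (v $ i) * Re (w $ j) * S (axis i 1) (axis j 1) + Re (v $ i) * Im (w $ j) * S (axis i 1) (axis j \<i>)
   + Im (v $ i) * Re (w $ j) * S (axis i \<i>) (axis j 1) + Im (v $ i) * Im (w $ j) * S (axis i \<i>) (axis j \<i>))"
proof -
  have rep: "v = (\<Sum>i\<in>UNIV. Re (v $ i) *\<^sub>R axis i 1 + Im (v $ i) *\<^sub>R axis i \<i>)" for v :: "complex ^ 'n"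
    by (simp add: vec_eq_iff axis_def complex_eq_iff if_distrib[of "\<lambda>x. _ * x"]
        if_distrib[of Re] if_distrib[of Im] cong: if_cong)
  have "S v w = S (\<Sum>i\<in>UNIV. Re (v $ i) *\<^sub>R axis i 1 + Im (v $ i) *\<^sub>R axis i \<i>)
      (\<Sum>j\<in>UNIV. Re (w $ j) *\<^sub>R axis j 1 + Im (w $ j) *\<^sub>R axis j \<i>)"
    using rep by metis
  also have "\<dots> = (\<Sum>i\<in>UNIV. \<Sum>j\<in>UNIV. S (Re (v $ i) *\<^sub>R axis i 1 + Im (v $ i) *\<^sub>R axis i \<i>)
      (Re (w $ j) *\<^sub>R axis j 1 + Im (w $ j) *\<^sub>R axis j \<i>))"
    by (simp add: bilinear_sum[OF S] sum.cartesian_product)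
  finally show ?thesis
    by (simp add: bilinear_ladd[OF S] bilinear_radd[OF S] bilinear_lmul[OF S] bilinear_rmul[OF S] algebra_simps)
qed

text \<open>With \<open>v = cnj_vec e\<close> the left side is a quarter of the Laplacian on the
  complex line through \<open>v\<close>. The conjugate appears because the unbarred index of
  \<open>hess_form\<close> is paired with \<open>cnj (e $ i)\<close>.\<close>

lemma Re_herm_inner_hess_form:
  fixes S :: "complex ^ 'n \<Rightarrow> complex ^ 'n \<Rightarrow> real"
  assumes S: "bilinear S"
  shows "Re (herm_inner e (hess_form S *v e)) =
    (S (cnj_vec e) (cnj_vec e) + S (rot_vec (cnj_vec e)) (rot_vec (cnj_vec e))) / 4"
proof -
  have "herm_inner e (hess_form S *v e) = (\<Sum>i\<in>UNIV. \<Sum>j\<in>UNIV. cnj (e $ i) * hess_form S $ i $ j * e $ j)"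
    by (simp add: herm_inner_def matrix_vector_mult_def sum_distrib_left mult.assoc)
  then show ?thesis
    unfolding bilinear_expand[OF S, of "cnj_vec e"] bilinear_expand[OF S, of "rot_vec (cnj_vec e)"]
    by (simp add: cnj_vec_def rot_vec_def hess_form_def sum_divide_distrib flip: sum.distrib)
      (intro sum.cong refl, simp add: field_simps)
qed

section \<open>The linearised operator on real Hessians\<close>

lemma frame_complete:
  assumes e: "orthonormal_frame e" and z: "\<And>i. herm_inner (e i) z = 0"
  shows "z = 0"
proof -
  define U V where "U = (\<chi> l j. e j $ l)" and "V = (\<chi> i l. cnj (e i $ l))"
  have "V ** U = mat 1"
    using e by (simp add: orthonormal_frame_def V_def U_def matrix_matrix_mult_def herm_inner_def mat_def vec_eq_iff)
  then have UV: "U ** V = mat 1" by (simp add: matrix_left_right_inverse)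
  have "V *v z = 0"
    using z by (simp add: V_def matrix_vector_mult_def herm_inner_def vec_eq_iff)
  then have "(U ** V) *v z = 0"
    by (simp only: matrix_vector_mult_0_right flip: matrix_vector_mul_assoc)
  with UV show ?thesis by simp
qed

lemma quot_deriv_hess_form_nonneg:
  fixes S :: "complex ^ 'n \<Rightarrow> complex ^ 'n \<Rightarrow> real"
  assumes "hermitian A" "1 \<le> k" "eigenvalues A \<in> Gamma_cone k" and S: "bilinear S" "\<And>v. S v v \<ge> 0"
  shows "quot_deriv k A (hess_form S) \<ge> 0"
proof -
  obtain e and c :: "'n \<Rightarrow> real" where ec: "orthonormal_frame e" "\<And>i. c i > 0"
    "\<And>B. quot_deriv k A B = (\<Sum>i\<in>UNIV. c i * Re (herm_inner (e i) (B *v e i)))"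
    "sum c UNIV \<le> real CARD('n) * (esym (k - 1) (eigenvalues A) / esym k (eigenvalues A))\<^sup>2"
    by (rule quot_deriv_frame[OF assms(1-3)]) (rule that)
  show ?thesis unfolding ec(3) Re_herm_inner_hess_form[OF S(1)]
    using S(2) ec(2) by (intro sum_nonneg mult_nonneg_nonneg) (auto intro: less_imp_le)
qed

text \<open>Each frame vector contributes a quarter of a squared component of
  \<open>cnj_vec y\<close>, and a full frame cannot be orthogonal to a nonzero vector. This
  positivity drives the Gaussian barrier.\<close>

lemma quot_deriv_hess_form_rank_one_pos:
  fixes y :: "complex ^ 'n"
  assumes "hermitian A" "1 \<le> k" "eigenvalues A \<in> Gamma_cone k" and "y \<noteq> 0"
  shows "quot_deriv k A (hess_form (\<lambda>v w. (v \<bullet> y) * (w \<bullet> y))) > 0"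
proof -
  obtain e and c :: "'n \<Rightarrow> real" where ec: "orthonormal_frame e" "\<And>i. c i > 0"
    "\<And>B. quot_deriv k A B = (\<Sum>i\<in>UNIV. c i * Re (herm_inner (e i) (B *v e i)))"
    "sum c UNIV \<le> real CARD('n) * (esym (k - 1) (eigenvalues A) / esym k (eigenvalues A))\<^sup>2"
    by (rule quot_deriv_frame[OF assms(1-3)]) (rule that)
  have S: "bilinear (\<lambda>v w. (v \<bullet> y) * (w \<bullet> y))"
    by (auto simp: bilinear_def algebra_simps intro!: linearI)
  have Q: "Re (herm_inner (e i) (hess_form (\<lambda>v w. (v \<bullet> y) * (w \<bullet> y)) *v e i))
      = (norm (herm_inner (e i) (cnj_vec y)))\<^sup>2 / 4" for i
  proof -
    have "cnj_vec (e i) \<bullet> y = Re (herm_inner (e i) (cnj_vec y))"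
      "rot_vec (cnj_vec (e i)) \<bullet> y = - Im (herm_inner (e i) (cnj_vec y))"
      by (auto simp: herm_inner_def cnj_vec_def rot_vec_def inner_vec_def inner_complex_def algebra_simps
          simp flip: sum_negf intro!: sum.cong)
    then show ?thesis unfolding Re_herm_inner_hess_form[OF S] by (simp add: cmod_power2 flip: power2_eq_square)
  qed
  have "cnj_vec y \<noteq> 0" using \<open>y \<noteq> 0\<close> by (auto simp: cnj_vec_def vec_eq_iff)
  then obtain i where "herm_inner (e i) (cnj_vec y) \<noteq> 0" using frame_complete[OF ec(1)] by blast
  then show ?thesis unfolding ec(3) Q
    using ec(2) by (intro sum_pos2[of _ i]) (auto intro!: mult_nonneg_nonneg less_imp_le[OF ec(2)])
qed

lemma quot_deriv_identity_le:
  fixes A :: "complex ^ 'n ^ 'n"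
  assumes "hermitian A" "1 \<le> k" "eigenvalues A \<in> Gamma_cone k"
  shows "quot_deriv k A (mat 1) \<le> real CARD('n) * (esym (k - 1) (eigenvalues A) / esym k (eigenvalues A))\<^sup>2"
proof -
  obtain e and c :: "'n \<Rightarrow> real" where ec: "orthonormal_frame e" "\<And>i. c i > 0"
    "\<And>B. quot_deriv k A B = (\<Sum>i\<in>UNIV. c i * Re (herm_inner (e i) (B *v e i)))"
    "sum c UNIV \<le> real CARD('n) * (esym (k - 1) (eigenvalues A) / esym k (eigenvalues A))\<^sup>2"
    by (rule quot_deriv_frame[OF assms(1-3)]) (rule that)
  then show ?thesis by (simp add: orthonormal_frame_def)
qed

lemma continuous_on_quot_deriv:
  fixes A B :: "'a::topological_space \<Rightarrow> complex ^ 'n ^ 'n"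
  assumes A: "\<And>i j. continuous_on T (\<lambda>x. A x $ i $ j)" and B: "\<And>i j. continuous_on T (\<lambda>x. B x $ i $ j)"
    and nz: "\<And>x. x \<in> T \<Longrightarrow> Re (coeff (gpoly (A x)) k) \<noteq> 0"
  shows "continuous_on T (\<lambda>x. quot_deriv k (A x) (B x))"
proof -
  define C :: "('a \<Rightarrow> complex poly) \<Rightarrow> bool" where "C f \<longleftrightarrow> (\<forall>m. continuous_on T (\<lambda>x. coeff (f x) m))" for f
  have mult: "C (\<lambda>x. f x * g x)" if "C f" "C g" for f g
    using that unfolding C_def coeff_mult by (auto intro!: continuous_intros)
  have const: "C (\<lambda>x. c)" for c by (simp add: C_def)
  have sum: "C (\<lambda>x. \<Sum>i\<in>S. f i x)" if "\<And>i. i \<in> S \<Longrightarrow> C (f i)" for S :: "'n set" and f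
    using that unfolding C_def coeff_sum by (auto intro!: continuous_intros)
  \<comment> \<open>The same closure property at a second index type: sums here run over matrix
    indices as well as over permutations.\<close>
  have sum': "C (\<lambda>x. \<Sum>i\<in>S. f i x)" if "\<And>i. i \<in> S \<Longrightarrow> C (f i)" for S :: "('n \<Rightarrow> 'n) set" and f
    using that unfolding C_def coeff_sum by (auto intro!: continuous_intros)
  have prod: "C (\<lambda>x. \<Prod>i\<in>S. f i x)" if "\<And>i. i \<in> S \<Longrightarrow> C (f i)" for S :: "'n set" and f
    using that by (induction S rule: infinite_finite_induct) (auto intro: mult const)
  have lin: "C (\<lambda>x. [:c, M x $ i $ j:])" if "\<And>i j. continuous_on T (\<lambda>x. M x $ i $ j)" for c i j
      and M :: "'a \<Rightarrow> complex ^ 'n ^ 'n"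
    unfolding C_def
  proof
    show "continuous_on T (\<lambda>x. coeff [:c, M x $ i $ j:] m)" for m
      by (cases m; cases "m - 1") (auto simp: that coeff_pCons)
  qed
  have "C (\<lambda>x. gpoly (A x))"
    unfolding gpoly_def det_def vec_lambda_beta
    by (intro sum' mult const prod lin A)
  moreover have "C (\<lambda>x. dgpoly (A x) (B x))"
    unfolding dgpoly_def by (intro sum' sum mult const prod lin A B)
  ultimately show ?thesis
    unfolding quot_deriv_def C_def using nz by (auto intro!: continuous_intros)
qed

section \<open>Self-shrinking solutions\<close>

lemma inner_real_grad:
  fixes u :: "complex ^ 'n \<Rightarrow> real"
  assumes "smooth u"
  shows "x \<bullet> real_grad u x = dird x u x"
proof -
  have lin: "linear (\<lambda>v. dird v u x)"
    by (rule has_derivative_linear[OF smooth_has_derivative[OF assms]])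
  have rep: "x = (\<Sum>i\<in>UNIV. Re (x $ i) *\<^sub>R axis i 1 + Im (x $ i) *\<^sub>R axis i \<i>)"
    by (simp add: vec_eq_iff axis_def complex_eq_iff if_distrib[of "\<lambda>x. _ * x"]
        if_distrib[of Re] if_distrib[of Im] cong: if_cong)
  have "dird x u x = dird (\<Sum>i\<in>UNIV. Re (x $ i) *\<^sub>R axis i 1 + Im (x $ i) *\<^sub>R axis i \<i>) u x"
    by (rule arg_cong[OF rep, of "\<lambda>v. dird v u x"])
  also have "\<dots> = (\<Sum>i\<in>UNIV. Re (x $ i) * dird (axis i 1) u x + Im (x $ i) * dird (axis i \<i>) u x)"
    using linear_sum[OF lin, of "\<lambda>i. Re (x $ i) *\<^sub>R axis i 1 + Im (x $ i) *\<^sub>R axis i \<i>" UNIV]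
    by (simp add: linear_add[OF lin] linear_scale[OF lin])
  finally show ?thesis
    by (simp add: inner_vec_def real_grad_def inner_complex_def dird_def partial_x_def partial_y_def)
qed

locale self_shrinker =
  fixes u :: "complex ^ 'n \<Rightarrow> real" and k :: nat
  assumes k: "1 \<le> k" and u: "smooth u"
    and psh: "\<And>x. eigenvalues (complex_hessian u x) \<in> Gamma_cone k"
    and eq: "\<And>x. - (esym (k - 1) (eigenvalues (complex_hessian u x)) /
                 esym k (eigenvalues (complex_hessian u x)))
              = 1 / 2 * (x \<bullet> real_grad u x) - u x"
begin

section \<open>The drift equation for \<open>f\<close>\<close>

definition H :: "complex ^ 'n \<Rightarrow> complex ^ 'n ^ 'n" where
  "H x = complex_hessian u x"

definition f :: "complex ^ 'n \<Rightarrow> real" where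
  "f x = esym (k - 1) (eigenvalues (H x)) / esym k (eigenvalues (H x))"

lemma H_eq: "H x = hess_form (\<lambda>v w. dird v (dird w u) x)"
  by (simp add: H_def complex_hessian_eq_hess_form[OF u])

lemma hermitian_H: "hermitian (H x)"
  unfolding H_eq by (rule hermitian_hess_form) (simp add: dird_commute[OF u])

lemma H_cone: "eigenvalues (H x) \<in> Gamma_cone k"
  using psh by (simp add: H_def)

lemma esym_H_pos: "esym k (eigenvalues (H x)) > 0" "esym (k - 1) (eigenvalues (H x)) > 0"
proof -
  show "esym k (eigenvalues (H x)) > 0" using H_cone k by (simp add: Gamma_cone_def)
  show "esym (k - 1) (eigenvalues (H x)) > 0"
  proof (cases "k = 1")
    case True
    then show ?thesis by (simp add: esym_eq_elem_sym)
  next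
    case False
    then show ?thesis using H_cone[of x] k by (simp add: Gamma_cone_def)
  qed
qed

lemma f_pos: "f x > 0"
  using esym_H_pos by (simp add: f_def)

lemma f_eq: "f x = u x - dird x u x / 2"
  using eq[of x] by (simp add: f_def H_def inner_real_grad[OF u])

definition f1 :: "complex ^ 'n \<Rightarrow> complex ^ 'n \<Rightarrow> real" where
  "f1 v x = (dird v u x - dird x (dird v u) x) / 2"

lemma f_has_derivative: "(f has_derivative (\<lambda>v. f1 v x)) (at x)"
proof -
  have "((\<lambda>x. u x - dird x u x / 2) has_derivative
      (\<lambda>v. dird v u x - (dird v u x + dird x (dird v u) x) / 2)) (at x)"
    using has_derivative_diff[OF smooth_has_derivative[OF u]
        has_derivative_mult_right[OF euler_has_derivative[OF u], of "1/2"]]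
    by simp
  moreover have "(\<lambda>x. u x - dird x u x / 2) = f" by (simp add: fun_eq_iff f_eq)
  moreover have "(\<lambda>v. dird v u x - (dird v u x + dird x (dird v u) x) / 2) = (\<lambda>v. f1 v x)"
    by (simp add: fun_eq_iff f1_def field_simps)
  ultimately show ?thesis by (simp only:)
qed

text \<open>The factor 1/2 is balanced for quadratic scaling: the second derivatives of
  \<open>u\<close> cancel, and only the third derivative along \<open>x\<close> is left.\<close>

lemma f1_has_derivative:
  "(f1 v has_derivative (\<lambda>w. - dird x (dird w (dird v u)) x / 2)) (at x)"
proof -
  have "((\<lambda>x. (1/2) * (dird v u x - dird x (dird v u) x)) has_derivative
      (\<lambda>w. (1/2) * (dird w (dird v u) x - (dird w (dird v u) x + dird x (dird w (dird v u)) x)))) (at x)"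
    by (intro has_derivative_mult_right has_derivative_diff euler_has_derivative smooth_has_derivative
        smooth_dird u)
  then show ?thesis by (simp add: f1_def[abs_def])
qed

lemma continuous_f: "continuous_on S f"
  by (rule has_derivative_continuous_on) (rule has_derivative_at_withinI[OF f_has_derivative])

definition Hd :: "complex ^ 'n \<Rightarrow> complex ^ 'n \<Rightarrow> complex ^ 'n ^ 'n" where
  "Hd x h = hess_form (\<lambda>v w. dird h (dird v (dird w u)) x)"

lemma H_has_derivative: "((\<lambda>y. H y $ i $ j) has_derivative (\<lambda>h. Hd x h $ i $ j)) (at x)"
proof -
  have C: "((\<lambda>y. complex_of_real (a y) + \<i> * complex_of_real (b y)) has_derivative
      (\<lambda>h. complex_of_real (a' h) + \<i> * complex_of_real (b' h))) (at x)"
    if "(a has_derivative a') (at x)" "(b has_derivative b') (at x)"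
    for a b :: "complex ^ 'n \<Rightarrow> real" and a' b'
    using that by (intro has_derivative_add has_derivative_mult_right has_derivative_of_real)
  show ?thesis
    unfolding H_eq Hd_def hess_form_def vec_lambda_beta Complex_eq
    by (intro has_derivative_mult_right C has_derivative_add has_derivative_diff
        smooth_has_derivative smooth_dird u)
qed

text \<open>This is the second reading of the derivative of \<open>f\<close>, through the quotient.
  With \<open>h = x\<close> it involves the same third derivatives as the Hessian of
  \<open>f\<close>.\<close>

lemma f1_eq_quot_deriv: "f1 h x = - quot_deriv k (H x) (Hd x h)"
proof -
  define a b where "a y = Re (coeff (gpoly (H y)) (k - 1))" and "b y = Re (coeff (gpoly (H y)) k)" for y
  define a' b' where "a' h = Re (coeff (dgpoly (H x) (Hd x h)) (k - 1))"
    and "b' h = Re (coeff (dgpoly (H x) (Hd x h)) k)" for h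
  have ab: "(a has_derivative a') (at x)" "(b has_derivative b') (at x)"
    unfolding a_def[abs_def] b_def[abs_def] a'_def[abs_def] b'_def[abs_def]
    by (intro has_derivative_Re gpoly_has_derivative H_has_derivative)+
  have f: "f = (\<lambda>y. a y / b y)"
    by (simp add: fun_eq_iff f_def a_def b_def coeff_gpoly_hermitian[OF hermitian_H])
  have b0: "b x \<noteq> 0" using esym_H_pos(1)[of x] by (simp add: b_def coeff_gpoly_hermitian[OF hermitian_H])
  have "(f has_derivative (\<lambda>h. (a' h * b x - a x * b' h) / (b x * b x))) (at x)"
    unfolding f by (rule has_derivative_divide'[OF ab b0])
  from has_derivative_unique[OF f_has_derivative this]
  have "f1 h x = (a' h * b x - a x * b' h) / (b x * b x)" by (simp add: fun_eq_iff)
  moreover have "quot_deriv k (H x) (Hd x h) = (a x * b' h - a' h * b x) / (b x * b x)"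
    by (simp only: quot_deriv_def a_def b_def a'_def b'_def power2_eq_square)
  ultimately show ?thesis by (simp add: minus_divide_left)
qed

text \<open>The drift Laplacian \<open>L g = F\<^sup>i\<^sup>j g\<^sub>i\<^sub>j - x \<bullet> Dg / 2\<close> annihilates \<open>f\<close>, so at a minimum of \<open>f + g\<close>
  we have \<open>L g \<ge> 0\<close>.\<close>

lemma drift_laplacian_at_minimum:
  assumes g: "\<And>y. (g has_derivative (\<lambda>v. dg v y)) (at y)"
    and dg: "\<And>v. (dg v has_derivative (\<lambda>w. d2g w v)) (at x)"
    and bil: "bilinear d2g"
    and min: "\<And>y. f x + g x \<le> f y + g y"
  shows "dg x x / 2 \<le> quot_deriv k (H x) (hess_form d2g)"
proof -
  define S where "S w v = d2g w v - dird x (dird w (dird v u)) x / 2" for w v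
  have D: "((\<lambda>y. f y + g y) has_derivative (\<lambda>v. f1 v y + dg v y)) (at y)" for y
    by (intro has_derivative_add f_has_derivative g)
  have D2: "((\<lambda>y. f1 v y + dg v y) has_derivative (\<lambda>w. S w v)) (at x)" for v
    using has_derivative_add[OF f1_has_derivative dg] by (simp add: S_def)
  have zero: "f1 v x + dg v x = 0" for v
  proof -
    have "(\<lambda>v. f1 v x + dg v x) = (\<lambda>v. 0)"
      by (rule differential_zero_maxmin[OF _ open_UNIV D]) (use min in auto)
    then show ?thesis by (simp add: fun_eq_iff)
  qed
  have "S v v \<ge> 0" for v
  proof (rule second_derivative_test)
    show "((\<lambda>t. f (x + t *\<^sub>R v) + g (x + t *\<^sub>R v)) has_real_derivative
        f1 v (x + t *\<^sub>R v) + dg v (x + t *\<^sub>R v)) (at t)" for t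
      by (rule has_derivative_along_line[OF D])
    have "((\<lambda>t. f1 v (x + t *\<^sub>R v) + dg v (x + t *\<^sub>R v)) has_derivative (\<lambda>h. S (h *\<^sub>R v) v)) (at 0)"
      by (rule has_derivative_compose[where g = "\<lambda>y. f1 v y + dg v y"])
        (auto intro!: derivative_eq_intros D2)
    moreover have "S (h *\<^sub>R v) v = S v v * h" for h
      using linear_scale[OF has_derivative_linear[OF D2[of v]]] by (simp add: mult.commute)
    ultimately show "((\<lambda>t. f1 v (x + t *\<^sub>R v) + dg v (x + t *\<^sub>R v)) has_real_derivative S v v) (at 0)"
      by (simp add: has_field_derivative_def)
  qed (use zero min in auto)
  moreover have "bilinear S"
  proof -
    note b = bil bilinear_third_dird[OF u, of x x]
    show ?thesis unfolding bilinear_def S_def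
      using b by (auto simp: bilinear_def linear_iff algebra_simps add_divide_distrib diff_divide_distrib)
  qed
  ultimately have "0 \<le> quot_deriv k (H x) (hess_form S)"
    by (intro quot_deriv_hess_form_nonneg hermitian_H k H_cone)
  also have "hess_form S = hess_form d2g - (1 / 2) *\<^sub>R Hd x x"
  proof -
    have "S = (\<lambda>w v. d2g w v - (1 / 2) * dird x (dird w (dird v u)) x)" by (simp add: S_def fun_eq_iff)
    then show ?thesis unfolding Hd_def by (simp only: hess_form_diff hess_form_cmult)
  qed
  also have "quot_deriv k (H x) (hess_form d2g - (1 / 2) *\<^sub>R Hd x x)
      = quot_deriv k (H x) (hess_form d2g) - quot_deriv k (H x) (Hd x x) / 2"
    by (simp add: quot_deriv_diff quot_deriv_scaleR del: scaleR_conv_of_real)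
  \<comment> \<open>Criticality of \<open>f + g\<close> gives \<open>f1 x x = - dg x x\<close>, and
    \<open>f1 x x\<close> is minus the operator applied to \<open>Hd x x\<close>.\<close>
  also have "\<dots> = quot_deriv k (H x) (hess_form d2g) - dg x x / 2"
    using zero[of x] by (simp add: f1_eq_quot_deriv)
  finally show ?thesis by simp
qed

lemma quot_deriv_identity_le_f: "quot_deriv k (H x) (mat 1) \<le> real CARD('n) * (f x)\<^sup>2"
  unfolding f_def by (rule quot_deriv_identity_le[OF hermitian_H k H_cone])

text \<open>Perturb by \<open>\<epsilon> \<bar>x\<bar>\<^sup>2\<close>: since \<open>f \<le> f 0\<close> at the resulting minimum and the trace of \<open>F\<^sup>i\<^sup>j\<close> is at most
  \<open>n f\<^sup>2\<close>, the minima stay in a fixed ball.\<close>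

lemma f_attains_minimum: "\<exists>x0. \<forall>y. f x0 \<le> f y"
proof -
  define N where "N = real CARD('n) * (f 0)\<^sup>2"
  have N: "N \<ge> 0" by (simp add: N_def)
  have near: "\<exists>x. norm x \<le> sqrt N \<and> (\<forall>y. f x + e * (x \<bullet> x) \<le> f y + e * (y \<bullet> y))" if e: "e > 0" for e
  proof -
    \<comment> \<open>Chosen so that \<open>e * R^2 = f 0\<close>: outside this ball the penalty
      alone reaches the value at the origin, because \<open>f\<close> is positive.\<close>
    define R where "R = sqrt (f 0 / e)"
    have R: "R \<ge> 0" "R\<^sup>2 = f 0 / e" using f_pos[of 0] e by (auto simp: R_def)
    have "continuous_on (cball 0 R) (\<lambda>x. f x + e * (x \<bullet> x))"
      by (intro continuous_intros continuous_f)
    then obtain x where x: "x \<in> cball 0 R" "\<And>y. y \<in> cball 0 R \<Longrightarrow> f x + e * (x \<bullet> x) \<le> f y + e * (y \<bullet> y)"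
      using continuous_attains_inf[of "cball 0 R" "\<lambda>x. f x + e * (x \<bullet> x)"] R by auto
    have min: "f x + e * (x \<bullet> x) \<le> f y + e * (y \<bullet> y)" for y
    proof (cases "y \<in> cball 0 R")
      case False
      then have "R\<^sup>2 \<le> (norm y)\<^sup>2" using R(1) by (intro power_mono) auto
      then have "f 0 \<le> e * (y \<bullet> y)" using e R(2) by (simp add: field_simps dot_square_norm)
      moreover have "f x + e * (x \<bullet> x) \<le> f 0" using x(2)[of 0] R(1) by simp
      ultimately show ?thesis using f_pos[of y] by linarith
    qed (use x(2) in auto)
    have "2 * e * (x \<bullet> x) / 2 \<le> quot_deriv k (H x) (hess_form (\<lambda>w v. e * (2 * (w \<bullet> v))))"
    proof (rule drift_laplacian_at_minimum[where dg = "\<lambda>v y. 2 * e * (v \<bullet> y)" and g = "\<lambda>y. e * (y \<bullet> y)"])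
      show "((\<lambda>y. e * (y \<bullet> y)) has_derivative (\<lambda>v. 2 * e * (v \<bullet> y))) (at y)" for y
        by (auto intro!: derivative_eq_intros simp: inner_commute)
      show "((\<lambda>y. 2 * e * (v \<bullet> y)) has_derivative (\<lambda>w. e * (2 * (w \<bullet> v)))) (at x)" for v
        by (auto intro!: derivative_eq_intros simp: inner_commute)
      show "bilinear (\<lambda>w v. e * (2 * (w \<bullet> v)))"
        by (auto simp: bilinear_def algebra_simps intro!: linearI)
      show "f x + e * (x \<bullet> x) \<le> f y + e * (y \<bullet> y)" for y by (rule min)
    qed
    then have "e * (x \<bullet> x) \<le> e * quot_deriv k (H x) (mat 1)"
      unfolding hess_form_cmult hess_form_inner[unfolded hess_form_cmult] quot_deriv_scaleR by simp
    then have "x \<bullet> x \<le> quot_deriv k (H x) (mat 1)" using e by simp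
    also have "\<dots> \<le> real CARD('n) * (f x)\<^sup>2" by (rule quot_deriv_identity_le_f)
    also have "\<dots> \<le> N"
    proof -
      have "f x \<le> f 0" using min[of 0] mult_nonneg_nonneg[OF less_imp_le[OF e] inner_ge_zero[of x]] by simp
      then show ?thesis unfolding N_def
        using f_pos[of x] by (intro mult_left_mono power_mono) (auto intro: less_imp_le)
    qed
    finally have "norm x \<le> sqrt N" by (simp add: real_le_rsqrt dot_square_norm)
    with min show ?thesis by blast
  qed
  have "compact (cball 0 (sqrt N) :: (complex ^ 'n) set)" by simp
  moreover have "cball 0 (sqrt N) \<noteq> ({} :: (complex ^ 'n) set)" using N by simp
  ultimately obtain x0 where x0: "\<And>y. y \<in> cball 0 (sqrt N) \<Longrightarrow> f x0 \<le> f y"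
    using continuous_attains_inf[OF _ _ continuous_f, of "cball 0 (sqrt N)"] by blast
  have "f x0 \<le> f y" for y
  proof (rule field_le_epsilon)
    fix d :: real assume d: "d > 0"
    \<comment> \<open>The radius \<open>sqrt N\<close> is independent of \<open>e\<close>, so
      \<open>e\<close> may be adapted to \<open>y\<close> to make the penalty at \<open>y\<close> at
      most \<open>d\<close>.\<close>
    define e where "e = d / (y \<bullet> y + 1)"
    have yy: "y \<bullet> y + 1 > 0" by (simp add: add_nonneg_pos)
    have e: "e > 0" using d yy by (simp add: e_def)
    obtain x where x: "norm x \<le> sqrt N" "f x + e * (x \<bullet> x) \<le> f y + e * (y \<bullet> y)" using near[OF e] by blast
    have "f x0 \<le> f x" using x0 x(1) by simp
    also have "\<dots> \<le> f x + e * (x \<bullet> x)" using e by simp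
    also have "\<dots> \<le> f y + e * (y \<bullet> y)" by (rule x(2))
    also have "e * (y \<bullet> y) \<le> e * (y \<bullet> y + 1)" using e by simp
    also have "e * (y \<bullet> y + 1) = d" using yy by (simp add: e_def)
    finally show "f x0 \<le> f y + d" by simp
  qed
  then show ?thesis by blast
qed

text \<open>The form is the real Hessian of \<open>- e * exp (- \<alpha> * |x - x1|^2)\<close>,
  where \<open>y\<close> stands for \<open>x - x1\<close> and \<open>p\<close> for the
  exponential.\<close>

lemma hess_form_gaussian:
  "hess_form (\<lambda>w v. - (e * ((4 * \<alpha>\<^sup>2 * ((w \<bullet> y) * (v \<bullet> y)) - \<alpha> * (2 * (w \<bullet> v))) * p)))
    = (- (e * p)) *\<^sub>R ((4 * \<alpha>\<^sup>2) *\<^sub>R hess_form (\<lambda>w v. (w \<bullet> y) * (v \<bullet> y)) - \<alpha> *\<^sub>R mat 1)"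
proof -
  have "(\<lambda>w v. - (e * ((4 * \<alpha>\<^sup>2 * ((w \<bullet> y) * (v \<bullet> y)) - \<alpha> * (2 * (w \<bullet> v))) * p)))
      = (\<lambda>w v. (- (e * p)) * (4 * \<alpha>\<^sup>2 * ((w \<bullet> y) * (v \<bullet> y)) - \<alpha> * (2 * (w \<bullet> v))))"
    by (simp add: fun_eq_iff algebra_simps)
  then show ?thesis by (simp only: hess_form_cmult hess_form_diff hess_form_inner[unfolded hess_form_cmult])
qed

text \<open>A Gaussian centred at a point where \<open>f\<close> is not minimal is a global strict subsolution away from
  that point; this replaces the usual local barrier in the strong maximum principle.\<close>

lemma f_constant: "f x1 = f x2"
proof -
  obtain x0 where x0: "\<And>y. f x0 \<le> f y" using f_attains_minimum by blast
  have "f x1 = f x0" for x1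
  proof (rule ccontr)
    assume "f x1 \<noteq> f x0"
    then have gt: "f x1 > f x0" using x0[of x1] by simp
    define m where "m = f x0"
    define \<eta> where "\<eta> = (f x1 - m) / 2"
    have \<eta>: "\<eta> > 0" using gt by (simp add: \<eta>_def m_def)
    have "continuous (at x1) f" using continuous_f[of UNIV] by (simp add: continuous_on_eq_continuous_at)
    then obtain r where r: "r > 0" "\<And>y. dist y x1 < r \<Longrightarrow> dist (f y) (f x1) < \<eta>"
      using \<eta> unfolding continuous_at_eps_delta by metis
    have ball: "f y > m + \<eta>" if "dist y x1 < r" for y
    proof -
      have "\<bar>f y - f x1\<bar> < \<eta>" using r(2)[OF that] by (simp add: dist_real_def)
      moreover have "f x1 = m + 2 * \<eta>" by (simp add: \<eta>_def field_simps)
      ultimately show ?thesis by linarith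
    qed
    define P where "P x = hess_form (\<lambda>w v. (w \<bullet> (x - x1)) * (v \<bullet> (x - x1)))" for x
    define M where "M = real CARD('n) * (m + 1)\<^sup>2"
    \<comment> \<open>Beyond this radius the drift term \<open>(x - x1) . x\<close> exceeds
      \<open>M\<close>, which bounds the trace wherever \<open>f\<close> is at most
      \<open>m + 1\<close>.\<close>
    define R where "R = norm x1 + M + 1"
    define K where "K = cball 0 R - ball x1 r"
    have M: "M \<ge> 0" by (simp add: M_def)
    have Ppos: "quot_deriv k (H x) (P x) > 0" if "x \<noteq> x1" for x
      unfolding P_def by (rule quot_deriv_hess_form_rank_one_pos[OF hermitian_H k H_cone]) (use that in simp)
    have far: "M < (x - x1) \<bullet> x" if "norm x > R" for x
    proof -
      have "M < 1 * (norm x - norm x1)" using that by (simp add: R_def)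
      also have "\<dots> \<le> norm x * (norm x - norm x1)"
        using that M norm_ge_zero[of x1] unfolding R_def by (intro mult_right_mono) linarith+
      also have "\<dots> \<le> (x - x1) \<bullet> x"
        using norm_cauchy_schwarz[of x1 x] by (simp add: inner_diff_left dot_square_norm power2_eq_square algebra_simps)
      finally show ?thesis .
    qed
    \<comment> \<open>On the compact set \<open>K\<close> this bounds the ratio that minimality of
      \<open>f + g\<close> forces to be at least \<open>4 * \<alpha>\<close>. The ball about
      \<open>x1\<close> is removed because \<open>P x1\<close> is zero.\<close>
    obtain A where A: "\<And>x. x \<in> K \<Longrightarrow> (quot_deriv k (H x) (mat 1) - (x - x1) \<bullet> x) / quot_deriv k (H x) (P x) \<le> A"
    proof (cases "K = {}")
      case False
      have contH: "continuous_on K (\<lambda>x. H x $ i $ j)" for i j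
        by (rule has_derivative_continuous_on) (rule has_derivative_at_withinI[OF H_has_derivative])
      have nz: "Re (coeff (gpoly (H x)) k) \<noteq> 0" for x
        using esym_H_pos(1)[of x] by (simp add: coeff_gpoly_hermitian[OF hermitian_H])
      have contP: "continuous_on K (\<lambda>x. P x $ i $ j)" for i j
        unfolding P_def hess_form_def vec_lambda_beta Complex_eq
        by (intro continuous_intros)
      have "x1 \<notin> K" using r by (simp add: K_def)
      then have "x \<noteq> x1" if "x \<in> K" for x using that by blast
      then have Pnz: "quot_deriv k (H x) (P x) \<noteq> 0" if "x \<in> K" for x
        using less_imp_neq[OF Ppos[of x]] that by metis
      define \<tau> where "\<tau> x = (quot_deriv k (H x) (mat 1) - (x - x1) \<bullet> x) / quot_deriv k (H x) (P x)" for x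
      have "continuous_on K \<tau>"
        unfolding \<tau>_def
        by (intro continuous_intros continuous_on_quot_deriv contH contP nz) (use Pnz in auto)
      moreover have "compact K" unfolding K_def by (intro compact_diff) auto
      ultimately obtain z where "\<forall>x\<in>K. \<tau> x \<le> \<tau> z"
        using continuous_attains_sup[OF _ False] by blast
      then show ?thesis by (intro that[of "\<tau> z"]) (simp add: \<tau>_def)
    qed (use that in auto)
    define \<alpha> where "\<alpha> = max A 1"
    have \<alpha>: "\<alpha> \<ge> 1" "\<alpha> \<ge> A" by (auto simp: \<alpha>_def)
    define \<psi> where "\<psi> x = exp (- \<alpha> * ((x - x1) \<bullet> (x - x1)))" for x
    have \<psi>: "\<psi> x > 0" "\<psi> x \<le> 1" for x using \<alpha>(1) by (auto simp: \<psi>_def)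
    \<comment> \<open>The bound by \<open>\<eta>\<close> keeps the minimum point of
      \<open>f + g\<close> out of the ball about \<open>x1\<close>; the bound by 1 keeps
      \<open>f\<close> below \<open>m + 1\<close> there.\<close>
    define \<epsilon> where "\<epsilon> = min \<eta> 1"
    have \<epsilon>: "\<epsilon> > 0" "\<epsilon> \<le> \<eta>" "\<epsilon> \<le> 1" using \<eta> by (auto simp: \<epsilon>_def)
    define g where "g x = - (\<epsilon> * \<psi> x)" for x
    have "cball x1 (dist x1 x0) \<noteq> {}" by simp
    moreover have "continuous_on (cball x1 (dist x1 x0)) (\<lambda>x. f x + g x)"
      unfolding g_def \<psi>_def by (intro continuous_intros continuous_f)
    ultimately obtain x where "\<forall>y\<in>cball x1 (dist x1 x0). f x + g x \<le> f y + g y"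
      using continuous_attains_inf[OF compact_cball, of x1 "dist x1 x0" "\<lambda>x. f x + g x"] by blast
    note x = this[rule_format]
    \<comment> \<open>Outside the ball through \<open>x0\<close> centred at \<open>x1\<close> the
      Gaussian is at most its value at \<open>x0\<close>, and \<open>f\<close> is at least
      \<open>f x0\<close>, so a minimum over the ball is global.\<close>
    have min: "f x + g x \<le> f y + g y" for y
    proof (cases "y \<in> cball x1 (dist x1 x0)")
      case False
      then have "norm (x0 - x1) \<le> norm (y - x1)" by (simp add: dist_norm norm_minus_commute)
      then have "(norm (x0 - x1))\<^sup>2 \<le> (norm (y - x1))\<^sup>2" by (intro power_mono) auto
      then have "\<psi> y \<le> \<psi> x0" using \<alpha>(1) by (simp add: \<psi>_def dot_square_norm)
      then have "g x0 \<le> g y" using \<epsilon>(1) by (simp add: g_def)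
      moreover have "f x + g x \<le> f x0 + g x0" by (rule x) simp
      ultimately show ?thesis using x0[of y] by linarith
    qed (rule x)
    have val: "f x < m + \<epsilon> * \<psi> x"
      using min[of x0] mult_pos_pos[OF \<epsilon>(1) \<psi>(1)[of x0]] unfolding g_def m_def by linarith
    also have "\<epsilon> * \<psi> x \<le> \<epsilon>" using \<epsilon>(1) \<psi>(2)[of x] by simp
    finally have fx: "f x < m + \<epsilon>" by simp
    have away: "\<not> dist x x1 < r" using ball[of x] fx \<epsilon>(2) by auto
    then have "x \<noteq> x1" using r(1) by auto
    have "2 * \<epsilon> * \<alpha> * ((x \<bullet> (x - x1)) * \<psi> x) / 2 \<le> quot_deriv k (H x) (hess_form (\<lambda>w v.
        - (\<epsilon> * ((4 * \<alpha>\<^sup>2 * ((w \<bullet> (x - x1)) * (v \<bullet> (x - x1))) - \<alpha> * (2 * (w \<bullet> v))) * \<psi> x))))"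
    proof (rule drift_laplacian_at_minimum[where dg = "\<lambda>v y. 2 * \<epsilon> * \<alpha> * ((v \<bullet> (y - x1)) * \<psi> y)"
          and g = g])
      have d\<psi>: "(\<psi> has_derivative (\<lambda>w. - 2 * \<alpha> * (w \<bullet> (y - x1)) * \<psi> y)) (at y)" for y
        unfolding \<psi>_def
        by (auto intro!: derivative_eq_intros simp: inner_commute)
      show "(g has_derivative (\<lambda>v. 2 * \<epsilon> * \<alpha> * ((v \<bullet> (y - x1)) * \<psi> y))) (at y)" for y
        unfolding g_def
        by (auto intro!: derivative_eq_intros d\<psi>)
      show "((\<lambda>y. 2 * \<epsilon> * \<alpha> * ((v \<bullet> (y - x1)) * \<psi> y)) has_derivative (\<lambda>w.
          - (\<epsilon> * ((4 * \<alpha>\<^sup>2 * ((w \<bullet> (x - x1)) * (v \<bullet> (x - x1))) - \<alpha> * (2 * (w \<bullet> v))) * \<psi> x)))) (at x)" for v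
        by (auto intro!: derivative_eq_intros d\<psi> simp: fun_eq_iff algebra_simps power2_eq_square inner_commute)
      show "bilinear (\<lambda>w v. - (\<epsilon> * ((4 * \<alpha>\<^sup>2 * ((w \<bullet> (x - x1)) * (v \<bullet> (x - x1))) - \<alpha> * (2 * (w \<bullet> v))) * \<psi> x)))"
        by (auto simp: bilinear_def inner_add_left inner_add_right algebra_simps intro!: linearI)
      show "f x + g x \<le> f y + g y" for y by (rule min)
    qed
    then have "(\<epsilon> * \<psi> x) * (\<alpha> * ((x - x1) \<bullet> x))
        \<le> (\<epsilon> * \<psi> x) * (\<alpha> * (quot_deriv k (H x) (mat 1) - 4 * \<alpha> * quot_deriv k (H x) (P x)))"
      unfolding hess_form_gaussian quot_deriv_scaleR quot_deriv_diff P_def[symmetric]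
      by (simp add: power2_eq_square algebra_simps diff_divide_distrib inner_commute)
    then have *: "4 * \<alpha> * quot_deriv k (H x) (P x) \<le> quot_deriv k (H x) (mat 1) - (x - x1) \<bullet> x"
      using \<epsilon>(1) \<psi>(1)[of x] \<alpha>(1) by (simp add: mult_le_cancel_left_pos)
    have Px: "quot_deriv k (H x) (P x) > 0" by (rule Ppos) fact
    show False
    proof (cases "norm x \<le> R")
      case True
      then have "x \<in> K" using away by (simp add: K_def dist_commute)
      then have "quot_deriv k (H x) (mat 1) - (x - x1) \<bullet> x \<le> A * quot_deriv k (H x) (P x)"
        using A Px by (simp add: divide_le_eq)
      also have "\<dots> \<le> \<alpha> * quot_deriv k (H x) (P x)" using \<alpha>(2) Px by simp
      also have "\<dots> < 4 * \<alpha> * quot_deriv k (H x) (P x)" using \<alpha>(1) Px by simp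
      finally show False using * by simp
    next
      case False
      have "quot_deriv k (H x) (mat 1) \<le> real CARD('n) * (f x)\<^sup>2" by (rule quot_deriv_identity_le_f)
      also have "\<dots> \<le> M" unfolding M_def
        using fx \<epsilon>(3) f_pos[of x] by (intro mult_left_mono power_mono) auto
      also have "\<dots> < (x - x1) \<bullet> x" using far False by simp
      finally have "4 * \<alpha> * quot_deriv k (H x) (P x) < 0" using * by simp
      moreover have "4 * \<alpha> * quot_deriv k (H x) (P x) > 0" using \<alpha>(1) Px by simp
      ultimately show False by simp
    qed
  qed
  then show ?thesis by metis
qed

lemma u_quadratic: "quadratic_polynomial u"
proof -
  define c where "c = f 0"
  have fc: "f = (\<lambda>x. c)" using f_constant by (auto simp: c_def)
  have f1: "f1 v x = 0" for v x
    using has_derivative_unique[OF f_has_derivative, of "\<lambda>_. 0" x] by (simp add: fc fun_eq_iff)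
  then have "f1 v = (\<lambda>x. 0)" for v by auto
  then have "((\<lambda>x. 0) has_derivative (\<lambda>w. - dird x (dird w (dird v u)) x / 2)) (at x)" for x v
    using f1_has_derivative[of v x] by (simp add: eta_contract_eq)
  from fun_cong[OF has_derivative_unique[OF this has_derivative_const]]
  have f2: "dird x (dird w (dird v u)) x = 0" for x v w by simp
  define S where "S v w = dird v (dird w u) 0" for v w
  have u2: "u x = S x x / 2 + c" for x
  proof -
    define G where "G = dird x (dird x u)"
    have smG: "smooth G" unfolding G_def by (intro smooth_dird u)
    have der: "((\<lambda>t. G (0 + t *\<^sub>R x)) has_real_derivative dird x G (0 + t *\<^sub>R x)) (at t)" for t
      by (rule has_derivative_along_line[OF smooth_has_derivative[OF smG]])
    \<comment> \<open>The relation \<open>f2\<close> at the point \<open>t x\<close> carries a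
      factor \<open>t\<close> from its direction. Dividing by it excludes \<open>t = 0\<close>,
      where continuity of \<open>G\<close> along the ray takes over.\<close>
    have z: "dird x G (t *\<^sub>R x) = 0" if "t \<noteq> 0" for t
      using f2[of "t *\<^sub>R x" x x] that by (simp add: G_def dird_scaleR_left[OF smG[unfolded G_def]])
    have "G (0 + 1 *\<^sub>R x) = G (0 + 0 *\<^sub>R x)"
    proof (rule DERIV_isconst_end[where f = "\<lambda>t. G (0 + t *\<^sub>R x)"])
      show "continuous_on {0..1} (\<lambda>t. G (0 + t *\<^sub>R x))"
        by (rule DERIV_atLeastAtMost_imp_continuous_on) (use der in blast)
      show "((\<lambda>t. G (0 + t *\<^sub>R x)) has_real_derivative 0) (at t)" if "0 < t" "t < 1" for t
        using der[of t] z[of t] that by simp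
    qed simp
    \<comment> \<open>Regularity at the origin enters here: \<open>G\<close> is constant on the ray
      down to 0, so its value is the Hessian at 0. The Euler relations for \<open>D_x u\<close> and
      for \<open>u\<close> then express \<open>u x\<close> through it.\<close>
    then have "G x = S x x" by (simp add: G_def S_def)
    moreover have "dird x u x = G x" using f1[of x x] by (simp add: f1_def G_def)
    moreover have "u x = dird x u x / 2 + c" using f_eq[of x] by (simp add: fc)
    ultimately show ?thesis by simp
  qed
  have bil: "bilinear S" unfolding S_def by (rule bilinear_second_dird[OF u])
  have "S x x = (\<Sum>p\<in>Basis. \<Sum>q\<in>Basis. S p q * (x \<bullet> p) * (x \<bullet> q))" for x
  proof -
    have "S x x = S (\<Sum>p\<in>Basis. (x \<bullet> p) *\<^sub>R p) (\<Sum>q\<in>Basis. (x \<bullet> q) *\<^sub>R q)"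
      by (simp add: euclidean_representation)
    also have "\<dots> = (\<Sum>p\<in>Basis. \<Sum>q\<in>Basis. S ((x \<bullet> p) *\<^sub>R p) ((x \<bullet> q) *\<^sub>R q))"
      by (simp only: bilinear_sum[OF bil] sum.cartesian_product)
    finally show ?thesis by (simp add: bilinear_lmul[OF bil] bilinear_rmul[OF bil] mult_ac)
  qed
  then have "u x = (\<Sum>p\<in>Basis. \<Sum>q\<in>Basis. (S p q / 2) * (x \<bullet> p) * (x \<bullet> q)) + (\<Sum>p\<in>Basis. 0 * (x \<bullet> p)) + c" for x
    unfolding u2[of x] by (simp add: sum_divide_distrib)
  then show ?thesis unfolding quadratic_polynomial_def
    by (intro exI[of _ "\<lambda>p q. S p q / 2"] exI[of _ "\<lambda>p. 0"] exI[of _ c]) blast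
qed

end

theorem theorem1p3:
  fixes u :: "complex ^ 'n \<Rightarrow> real" and k :: nat
  assumes "1 \<le> k" and "k \<le> CARD('n)"
    and "smooth u"
    and "k_plurisubharmonic k u"
    and "\<And>x. - (esym (k - 1) (eigenvalues (complex_hessian u x)) /
                 esym k (eigenvalues (complex_hessian u x)))
              = 1 / 2 * (x \<bullet> real_grad u x) - u x"
  shows "quadratic_polynomial u"
proof -
  interpret self_shrinker u k
    using assms by unfold_locales (auto simp: k_plurisubharmonic_def)
  show ?thesis by (rule u_quadratic)
qed

end
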